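(* Let $c \ge 1$ be an integer. For any monoid $\mathbf{M}$, the following are equivalent: (1) $\mathbf{M}$ is a submonoid of a $c$-nilpotent lattice-ordered group. (2) $\mathbf{M}$ is $c$-nilpotent, cancellative, and has unique roots. (3) $\mathbf{M}$ has a group of quotients $\mathbf{G}(\mathbf{M})$ that is $c$-nilpotent and torsion-free. (4) $\mathbf{M}$ is a submonoid of a totally ordered $c$-nilpotent group. (5) $\mathbf{M}$ is a submonoid of a $c$-nilpotent cancellative residuated lattice.
   Context: A residuated lattice is an algebra $\langle L,\wedge,\vee,\cdot,\backslash,/,\mathrm{e}\rangle$ such that $\langle L,\cdot,\mathrm{e}\rangle$ is a monoid, $\langle L,\wedge,\vee\rangle$ is a lattice, and for all $a,b,d\in L$: $ab\le d \iff a\le d/b \iff b\le a\backslash d$. It is cancellative if its monoid reduct is a cancellative monoid. Define monoid terms $q_c(x,y,\bar z)$ for $c\ge 1$, with $\bar z=z_1,z_2,\dots$, by $q_1(x,y,\bar z)=xy$ and $q_{c+1}(x,y,\bar z)=q_c(x,y,\bar z)\,z_c\,q_c(y,x,\bar z)$. Let $\mathsf{L}_c$ be the equation $q_c(x,y,\bar z)\approx q_c(y,x,\bar z)$. A monoid is $c$-nilpotent if it satisfies $\mathsf{L}_c$; a residuated lattice is $c$-nilpotent if its monoid reduct is. A group is $c$-nilpotent if it has a central series of length at most $c$, i.e. it satisfies $[[[x_1,x_2],\dots,x_c],x_{c+1}]\approx \mathrm{e}$. A lattice-ordered group (a group with a lattice structure such that the group operation distributes over the lattice operations), or a totally ordered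 group (a group with a total order invariant under left and right multiplication), is $c$-nilpotent if its underlying group is. A monoid $\mathbf{M}$ has unique roots if $a^n=b^n$ with $a,b\in M$ and $n\ge 1$ implies $a=b$. A group of (left) quotients of a monoid $\mathbf{M}$ is a group $\mathbf{G}(\mathbf{M})$ that has $\mathbf{M}$ as a submonoid and in which every element is of the form $a^{-1}b$ with $a,b\in M$; it is unique up to isomorphism when it exists for cancellative $\mathbf{M}$. "$\mathbf{M}$ is a submonoid of the structure $\mathbf{B}$" means that $\mathbf{M}$ is (up to isomorphism) a submonoid of the monoid reduct of $\mathbf{B}$. *)

theory Defs
  imports "HOL-Algebra.Algebra" "HOL-Library.Equipollence"
begin

section \<open>Ordered structures\<close>

text \<open>
  An ordered monoid is given by a monoid \<open>G\<close> and an order \<open>L\<close> on the same carrier, so that the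
  library's notions of monoid, group, lattice and total order apply literally.
\<close>

locale lattice_ordered_group = group G + lattice L for G (structure) and L +
  assumes carrier_eq: "carrier L = carrier G"
    and mult_join: "\<lbrakk>a \<in> carrier G; x \<in> carrier G; y \<in> carrier G\<rbrakk>
          \<Longrightarrow> a \<otimes> (x \<squnion>\<^bsub>L\<^esub> y) = (a \<otimes> x) \<squnion>\<^bsub>L\<^esub> (a \<otimes> y)"
    and join_mult: "\<lbrakk>a \<in> carrier G; x \<in> carrier G; y \<in> carrier G\<rbrakk>
          \<Longrightarrow> (x \<squnion>\<^bsub>L\<^esub> y) \<otimes> a = (x \<otimes> a) \<squnion>\<^bsub>L\<^esub> (y \<otimes> a)"
    and mult_meet: "\<lbrakk>a \<in> carrier G; x \<in> carrier G; y \<in> carrier G\<rbrakk>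
          \<Longrightarrow> a \<otimes> (x \<sqinter>\<^bsub>L\<^esub> y) = (a \<otimes> x) \<sqinter>\<^bsub>L\<^esub> (a \<otimes> y)"
    and meet_mult: "\<lbrakk>a \<in> carrier G; x \<in> carrier G; y \<in> carrier G\<rbrakk>
          \<Longrightarrow> (x \<sqinter>\<^bsub>L\<^esub> y) \<otimes> a = (x \<otimes> a) \<sqinter>\<^bsub>L\<^esub> (y \<otimes> a)"

locale totally_ordered_group = group G + total_order L for G (structure) and L +
  assumes carrier_eq: "carrier L = carrier G"
    and mult_left_mono: "\<lbrakk>a \<in> carrier G; x \<in> carrier G; y \<in> carrier G; x \<sqsubseteq>\<^bsub>L\<^esub> y\<rbrakk>
          \<Longrightarrow> a \<otimes> x \<sqsubseteq>\<^bsub>L\<^esub> a \<otimes> y"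
    and mult_right_mono: "\<lbrakk>a \<in> carrier G; x \<in> carrier G; y \<in> carrier G; x \<sqsubseteq>\<^bsub>L\<^esub> y\<rbrakk>
          \<Longrightarrow> x \<otimes> a \<sqsubseteq>\<^bsub>L\<^esub> y \<otimes> a"

text \<open>\<open>ldiv a d\<close> is \<open>a\<close> under \<open>d\<close> (left residual), \<open>rdiv d b\<close> is \<open>d\<close> over \<open>b\<close> (right residual).\<close>

locale residuated_lattice = monoid G + lattice L for G (structure) and L +
  fixes ldiv :: "'a \<Rightarrow> 'a \<Rightarrow> 'a" and rdiv :: "'a \<Rightarrow> 'a \<Rightarrow> 'a"
  assumes carrier_eq: "carrier L = carrier G"
    and ldiv_closed: "\<lbrakk>a \<in> carrier G; d \<in> carrier G\<rbrakk> \<Longrightarrow> ldiv a d \<in> carrier G"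
    and rdiv_closed: "\<lbrakk>d \<in> carrier G; b \<in> carrier G\<rbrakk> \<Longrightarrow> rdiv d b \<in> carrier G"
    and residuation_right: "\<lbrakk>a \<in> carrier G; b \<in> carrier G; d \<in> carrier G\<rbrakk>
          \<Longrightarrow> a \<otimes> b \<sqsubseteq>\<^bsub>L\<^esub> d \<longleftrightarrow> a \<sqsubseteq>\<^bsub>L\<^esub> rdiv d b"
    and residuation_left: "\<lbrakk>a \<in> carrier G; b \<in> carrier G; d \<in> carrier G\<rbrakk>
          \<Longrightarrow> a \<otimes> b \<sqsubseteq>\<^bsub>L\<^esub> d \<longleftrightarrow> b \<sqsubseteq>\<^bsub>L\<^esub> ldiv a d"

section \<open>Monoids\<close>

text \<open>The terms \<open>q\<^sub>c\<close> are only specified for \<open>c \<ge> 1\<close>.\<close>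

fun q_term :: "('a, 'm) monoid_scheme \<Rightarrow> nat \<Rightarrow> 'a \<Rightarrow> 'a \<Rightarrow> (nat \<Rightarrow> 'a) \<Rightarrow> 'a" where
  "q_term M (Suc 0) x y z = x \<otimes>\<^bsub>M\<^esub> y"
| "q_term M (Suc (Suc c)) x y z =
     q_term M (Suc c) x y z \<otimes>\<^bsub>M\<^esub> z (Suc c) \<otimes>\<^bsub>M\<^esub> q_term M (Suc c) y x z"

definition nilpotent_monoid :: "nat \<Rightarrow> ('a, 'm) monoid_scheme \<Rightarrow> bool" where
  "nilpotent_monoid c M \<longleftrightarrow> monoid M \<and>
     (\<forall>x \<in> carrier M. \<forall>y \<in> carrier M. \<forall>z \<in> UNIV \<rightarrow> carrier M. q_term M c x y z = q_term M c y x z)"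

definition unique_roots :: "('a, 'm) monoid_scheme \<Rightarrow> bool" where
  "unique_roots M \<longleftrightarrow>
     (\<forall>a \<in> carrier M. \<forall>b \<in> carrier M. \<forall>n::nat. n \<ge> 1 \<longrightarrow> a [^]\<^bsub>M\<^esub> n = b [^]\<^bsub>M\<^esub> n \<longrightarrow> a = b)"

text \<open>
  Up to isomorphism. HOL cannot quantify existentially over types, so ``there is a structure having
  \<open>M\<close> as a submonoid'' is read as ``there is one on the type \<open>'b\<close>'', for an arbitrary type \<open>'b\<close>
  with \<open>carrier M \<lesssim> (UNIV :: 'b set)\<close>. That condition follows from the existence of any such
  structure on \<open>'b\<close> (lemma below), so it excludes no ambient structure, and it always holds
  for \<open>'b = 'a\<close>.
\<close>

definition submonoid_of :: "('a, 'm) monoid_scheme \<Rightarrow> ('b, 'n) monoid_scheme \<Rightarrow> bool" where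
  "submonoid_of M B \<longleftrightarrow> (\<exists>H. submonoid H B \<and> M \<cong> B\<lparr>carrier := H\<rparr>)"

lemma submonoid_of_imp_lepoll:
  fixes M :: "('a, 'm) monoid_scheme" and B :: "('b, 'n) monoid_scheme"
  assumes "submonoid_of M B"
  shows "carrier M \<lesssim> (UNIV :: 'b set)"
  using assms by (auto simp: submonoid_of_def is_iso_def iso_def lepoll_def bij_betw_def)

definition group_of_quotients :: "('b, 'n) monoid_scheme \<Rightarrow> ('a, 'm) monoid_scheme \<Rightarrow> bool" where
  "group_of_quotients G M \<longleftrightarrow> group G \<and>
     (\<exists>H. submonoid H G \<and> M \<cong> G\<lparr>carrier := H\<rparr> \<and>
        (\<forall>g \<in> carrier G. \<exists>a \<in> H. \<exists>b \<in> H. g = inv\<^bsub>G\<^esub> a \<otimes>\<^bsub>G\<^esub> b))"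

section \<open>Groups\<close>

definition torsion_free :: "('a, 'm) monoid_scheme \<Rightarrow> bool" where
  "torsion_free G \<longleftrightarrow>
     (\<forall>x \<in> carrier G. \<forall>n::nat. n \<ge> 1 \<longrightarrow> x [^]\<^bsub>G\<^esub> n = \<one>\<^bsub>G\<^esub> \<longrightarrow> x = \<one>\<^bsub>G\<^esub>)"

definition commutator :: "('a, 'm) monoid_scheme \<Rightarrow> 'a \<Rightarrow> 'a \<Rightarrow> 'a" where
  "commutator G x y = inv\<^bsub>G\<^esub> x \<otimes>\<^bsub>G\<^esub> inv\<^bsub>G\<^esub> y \<otimes>\<^bsub>G\<^esub> x \<otimes>\<^bsub>G\<^esub> y"

text \<open>
  In a central series each factor \<open>H (i + 1) / H i\<close> is central in \<open>G / H i\<close>; the last condition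
  says this in terms of commutators.
\<close>

definition central_series :: "('a, 'm) monoid_scheme \<Rightarrow> nat \<Rightarrow> (nat \<Rightarrow> 'a set) \<Rightarrow> bool" where
  "central_series G d H \<longleftrightarrow> H 0 = {\<one>\<^bsub>G\<^esub>} \<and> H d = carrier G \<and> (\<forall>i \<le> d. H i \<lhd> G) \<and>
     (\<forall>i < d. H i \<subseteq> H (Suc i) \<and>
        (\<forall>x \<in> H (Suc i). \<forall>g \<in> carrier G. commutator G x g \<in> H i))"

definition nilpotent_group :: "nat \<Rightarrow> ('a, 'm) monoid_scheme \<Rightarrow> bool" where
  "nilpotent_group c G \<longleftrightarrow> group G \<and> (\<exists>d \<le> c. \<exists>H. central_series G d H)"

text \<open>\<open>left_normed_commutator G n x\<close> is \<open>[[[x 0, x 1], \<dots>], x n]\<close>.\<close>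

primrec left_normed_commutator :: "('a, 'm) monoid_scheme \<Rightarrow> nat \<Rightarrow> (nat \<Rightarrow> 'a) \<Rightarrow> 'a" where
  "left_normed_commutator G 0 x = x 0"
| "left_normed_commutator G (Suc n) x = commutator G (left_normed_commutator G n x) (x (Suc n))"

context group
begin

lemma commutator_closed [simp]:
  "\<lbrakk>x \<in> carrier G; y \<in> carrier G\<rbrakk> \<Longrightarrow> commutator G x y \<in> carrier G"
  by (simp add: commutator_def)

lemma cancel_simps:
  assumes "x \<in> carrier G" "y \<in> carrier G"
  shows "x \<otimes> (inv x \<otimes> y) = y" "inv x \<otimes> (x \<otimes> y) = y"
  using assms by (simp_all add: m_assoc[symmetric])

lemma commutator_identities:
  assumes "x \<in> carrier G" "y \<in> carrier G" "g \<in> carrier G"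
  shows "commutator G (x \<otimes> y) g = (inv y \<otimes> commutator G x g \<otimes> y) \<otimes> commutator G y g"
    and "commutator G (inv x) g = x \<otimes> inv (commutator G x g) \<otimes> inv x"
    and "commutator G (y \<otimes> x \<otimes> inv y) g = y \<otimes> commutator G x (inv y \<otimes> g \<otimes> y) \<otimes> inv y"
  using assms by (simp_all add: commutator_def m_assoc inv_mult_group cancel_simps)

lemma normal_relative_centre:
  assumes N: "N \<lhd> G"
  shows "{x \<in> carrier G. \<forall>g \<in> carrier G. commutator G x g \<in> N} \<lhd> G" (is "?Z \<lhd> G")
proof -
  interpret N: normal N G by (rule N)
  have conj: "y \<otimes> n \<otimes> inv y \<in> N" "inv y \<otimes> n \<otimes> y \<in> N" if "y \<in> carrier G" "n \<in> N" for y n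
    using N.inv_op_closed1 N.inv_op_closed2 that by auto
  have "subgroup ?Z G"
  proof (rule subgroupI)
    show "?Z \<subseteq> carrier G" by blast
    have "\<one> \<in> ?Z" by (simp add: commutator_def)
    then show "?Z \<noteq> {}" by blast
    show "inv a \<in> ?Z" if "a \<in> ?Z" for a
      using that by (simp add: commutator_identities(2) conj)
    show "a \<otimes> b \<in> ?Z" if "a \<in> ?Z" "b \<in> ?Z" for a b
      using that by (simp add: commutator_identities(1) conj)
  qed
  then show ?thesis
    by (rule normal_invI) (simp add: commutator_identities(3) conj)
qed

lemma nilpotent_group_iff_commutator_identity:
  "nilpotent_group c G \<longleftrightarrow> (\<forall>x \<in> UNIV \<rightarrow> carrier G. left_normed_commutator G c x = \<one>)"
proof
  assume "nilpotent_group c G"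
  then obtain d H where d: "d \<le> c" and H: "central_series G d H"
    unfolding nilpotent_group_def by blast
  have H0: "H 0 = {\<one>}" and Hd: "H d = carrier G"
    and step: "\<And>i x g. \<lbrakk>i < d; x \<in> H (Suc i); g \<in> carrier G\<rbrakk> \<Longrightarrow> commutator G x g \<in> H i"
    using H by (auto simp: central_series_def)
  show "\<forall>x \<in> UNIV \<rightarrow> carrier G. left_normed_commutator G c x = \<one>"
  proof
    fix x :: "nat \<Rightarrow> 'a" assume x: "x \<in> UNIV \<rightarrow> carrier G"
    have "left_normed_commutator G i x \<in> H (d - i)" if "i \<le> d" for i
      using that
    proof (induction i)
      case (Suc i)
      have "d - i = Suc (d - Suc i)" using Suc.prems by simp
      then show ?case using Suc x step[of "d - Suc i" "left_normed_commutator G i x"] by auto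
    qed (use x Hd in auto)
    then have one: "left_normed_commutator G d x = \<one>" using H0 by force
    show "left_normed_commutator G c x = \<one>"
      using d
    proof (induction c rule: dec_induct)
      case (step n)
      have "x (Suc n) \<in> carrier G" using x by blast
      then show ?case using step by (simp add: commutator_def)
    qed (rule one)
  qed
next
  assume id: "\<forall>x \<in> UNIV \<rightarrow> carrier G. left_normed_commutator G c x = \<one>"
  define Z where "Z = rec_nat {\<one>} (\<lambda>_ N. {x \<in> carrier G. \<forall>g \<in> carrier G. commutator G x g \<in> N})"
  have Z0: "Z 0 = {\<one>}"
    and ZS: "\<And>i. Z (Suc i) = {x \<in> carrier G. \<forall>g \<in> carrier G. commutator G x g \<in> Z i}"
    by (simp_all add: Z_def)
  have nZ: "Z i \<lhd> G" for i
    by (induction i) (simp_all only: Z0 ZS one_is_normal normal_relative_centre)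
  have mono: "Z i \<subseteq> Z (Suc i)" for i
  proof (induction i)
    case 0
    then show ?case by (simp add: Z0 ZS commutator_def)
  next
    case (Suc i)
    then show ?case unfolding ZS[of "Suc i"] ZS[of i] by blast
  qed
  have mem: "y \<in> Z i" if "y \<in> carrier G"
    and "\<forall>x \<in> UNIV \<rightarrow> carrier G. x 0 = y \<longrightarrow> left_normed_commutator G i x = \<one>" for y i
    using that
  proof (induction i arbitrary: y)
    case 0
    then show ?case by (auto simp: Z0 dest: bspec[of _ _ "\<lambda>_. y"])
  next
    case (Suc i)
    have "commutator G y g \<in> Z i" if g: "g \<in> carrier G" for g
    proof (rule Suc.IH)
      show "\<forall>x \<in> UNIV \<rightarrow> carrier G. x 0 = commutator G y g \<longrightarrow> left_normed_commutator G i x = \<one>"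
      proof (intro ballI impI)
        fix x :: "nat \<Rightarrow> 'a" assume x: "x \<in> UNIV \<rightarrow> carrier G" "x 0 = commutator G y g"
        define x' where "x' n = (case n of 0 \<Rightarrow> y | Suc 0 \<Rightarrow> g | Suc (Suc m) \<Rightarrow> x (Suc m))" for n
        have "left_normed_commutator G (Suc n) x' = left_normed_commutator G n x" for n
          by (induction n) (simp_all add: x'_def x(2))
        moreover have "x' \<in> UNIV \<rightarrow> carrier G"
          using g Suc.prems(1) funcset_mem[OF x(1)] by (auto simp: x'_def split: nat.split)
        moreover have "x' 0 = y" by (simp add: x'_def)
        ultimately show "left_normed_commutator G i x = \<one>" using Suc.prems(2) by metis
      qed
    qed (use g Suc.prems in simp)
    then show ?case using Suc.prems(1) by (simp add: ZS)
  qed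
  have "Z c = carrier G"
  proof
    show "Z c \<subseteq> carrier G" using nZ normal_imp_subgroup subgroup.subset by blast
    show "carrier G \<subseteq> Z c" using mem id by blast
  qed
  then have "central_series G c Z"
    using Z0 nZ mono by (auto simp: central_series_def ZS)
  then show "nilpotent_group c G" by (auto simp: nilpotent_group_def is_group)
qed

end

section \<open>Equivalence of a list of statements\<close>

definition all_equivalent :: "bool list \<Rightarrow> bool" where
  "all_equivalent Ps \<longleftrightarrow> (\<forall>P \<in> set Ps. \<forall>Q \<in> set Ps. P \<longleftrightarrow> Q)"

end

theory Submission
  imports Defs
begin

text \<open>
  The five conditions are linked in a cycle: a totally ordered group is a lattice-ordered group, a
  lattice-ordered group is a cancellative residuated lattice, a submonoid of a nilpotent
  cancellative residuated lattice has unique roots, a nilpotent cancellative monoid with unique roots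
  has a torsion-free nilpotent group of quotients, and such a group can be totally ordered. Four
  ideas carry the proof.

  The law \<open>L\<^sub>c\<close> on a submonoid \<open>H\<close> whose quotients exhaust a group \<open>G\<close> says that \<open>G\<close> is
  \<open>c\<close>-nilpotent. In \<open>u z v = v z u\<close>, with \<open>z\<close> ranging over \<open>H\<close>, the element \<open>v\<inverse> u\<close> is central; so
  the law of index \<open>c\<close> in \<open>G\<close> becomes the law of index \<open>c - 1\<close> modulo the centre, until
  commutativity is reached (\<open>nilpotent_of_generating_submonoid\<close>, and
  \<open>nilpotent_group_imp_nilpotent_monoid\<close> for the converse).

  The law also provides common multiples on both sides (\<open>nilpotent_cancel_ore\<close>), so a nilpotent
  cancellative monoid is an Ore monoid and has a group of quotients (\<open>ore_group_of_quotients\<close>).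

  In a nilpotent group, a torsion-free centre makes all factors of the upper central series
  torsion-free, and this yields unique roots (\<open>nilpotent_unique_roots\<close>). A central torsion element
  of a group of quotients is \<open>a\<inverse> b\<close> with commuting \<open>a\<close> and \<open>b\<close> in the monoid that have a common
  power. For a monoid with unique roots this forces \<open>a = b\<close> at once. For a cancellative residuated
  lattice it follows by comparing \<open>a J\<close> with \<open>b J\<close>, where \<open>J\<close> is the join of the products
  \<open>a\<^sup>n\<^sup>-\<^sup>1\<^sup>-\<^sup>i b\<^sup>i\<close> (\<open>residuated_lattice.commuting_roots_unique\<close>). The order is never extended to the
  group of quotients.

  Each torsion-free factor of the upper central series has a total order by Zorn's lemma, and the
  lexicographic combination of these orders is invariant under multiplication on both sides, since
  conjugation acts trivially on the factors (\<open>upper_central_positive_cone\<close>).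

  The group of quotients exists on the required type because it injects into pairs of elements of
  the monoid, and the square of a cancellative monoid with unique roots is no larger than the monoid
  (\<open>unique_roots_square_lepoll\<close>).
\<close>

section \<open>The upper central series\<close>

text \<open>
  The upper central series; the value at \<open>i\<close> is usually written \<open>Z\<^sub>i(G)\<close>.
\<close>

primrec upper_central :: "('a, 'm) monoid_scheme \<Rightarrow> nat \<Rightarrow> 'a set" where
  "upper_central G 0 = {\<one>\<^bsub>G\<^esub>}"
| "upper_central G (Suc i) =
     {x \<in> carrier G. \<forall>g \<in> carrier G. commutator G x g \<in> upper_central G i}"

context group
begin

lemma upper_central_normal: "upper_central G i \<lhd> G"
  by (induction i) (simp_all only: upper_central.simps one_is_normal normal_relative_centre)

lemma upper_central_carrier: "upper_central G i \<subseteq> carrier G"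
  using upper_central_normal normal_imp_subgroup subgroup.subset by blast

lemma upper_central_Suc_mono: "upper_central G i \<subseteq> upper_central G (Suc i)"
proof (induction i)
  case 0
  then show ?case by (simp add: commutator_def)
next
  case (Suc i)
  then show ?case
    unfolding upper_central.simps(2)[of G "Suc i"] upper_central.simps(2)[of G i] by blast
qed

lemma upper_central_mono: "i \<le> j \<Longrightarrow> upper_central G i \<subseteq> upper_central G j"
  using lift_Suc_mono_le[of "upper_central G"] upper_central_Suc_mono by blast

text \<open>
  The upper central series dominates every central series, step by step. This makes nilpotency of
  class at most \<open>c\<close> the single equation \<open>Z\<^sub>c = G\<close>.
\<close>

lemma nilpotent_group_iff_upper_central:
  "nilpotent_group c G \<longleftrightarrow> upper_central G c = carrier G"
proof
  assume "nilpotent_group c G"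
  then obtain d H where d: "d \<le> c" and H: "central_series G d H"
    unfolding nilpotent_group_def by blast
  have "H i \<subseteq> upper_central G i" if "i \<le> d" for i
    using that
  proof (induction i)
    case 0
    then show ?case using H by (simp add: central_series_def)
  next
    case (Suc i)
    have "H (Suc i) \<subseteq> carrier G"
      using H Suc.prems by (simp add: central_series_def normal_imp_subgroup subgroup.subset)
    then show ?case
      using H Suc by (auto simp: central_series_def Suc_le_eq)
  qed
  then have "carrier G \<subseteq> upper_central G d"
    using H by (auto simp: central_series_def)
  then show "upper_central G c = carrier G"
    using upper_central_mono[OF d] upper_central_carrier by blast
next
  assume c: "upper_central G c = carrier G"
  have "central_series G c (upper_central G)"
    unfolding central_series_def
    using c upper_central_normal upper_central_Suc_mono by auto
  then show "nilpotent_group c G"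
    by (auto simp: nilpotent_group_def is_group)
qed

text \<open>
  Computations modulo a normal subgroup \<open>N\<close> are done in the image of a surjection with kernel
  \<open>N\<close>, so that congruences become equations in a group and no cosets appear.
\<close>

lemma normal_quotient_hom:
  assumes "N \<lhd> G"
  obtains Q :: "'a set monoid" and h where "group_hom G Q h" "h ` carrier G = carrier Q"
    "\<forall>x \<in> carrier G. h x = \<one>\<^bsub>Q\<^esub> \<longleftrightarrow> x \<in> N"
proof
  interpret N: normal N G by (rule assms)
  show "group_hom G (G Mod N) ((#>) N)"
    by (simp add: group_hom_def group_hom_axioms_def is_group N.factorgroup_is_group N.r_coset_hom_Mod)
  show "(#>) N ` carrier G = carrier (G Mod N)"
    by (simp add: carrier_FactGroup)
  show "\<forall>x \<in> carrier G. N #> x = \<one>\<^bsub>G Mod N\<^esub> \<longleftrightarrow> x \<in> N"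
    using coset_join1[of N] coset_join2[of _ N] N.subgroup_axioms by auto
qed

lemma inv_mult_eq_one_iff:
  "\<lbrakk>x \<in> carrier G; y \<in> carrier G\<rbrakk> \<Longrightarrow> inv x \<otimes> y = \<one> \<longleftrightarrow> x = y"
  by (metis inv_closed inv_equality inv_inv l_inv)

lemma commutator_eq_one_iff:
  assumes "x \<in> carrier G" "y \<in> carrier G"
  shows "commutator G x y = \<one> \<longleftrightarrow> x \<otimes> y = y \<otimes> x"
proof -
  have "commutator G x y = inv (y \<otimes> x) \<otimes> (x \<otimes> y)"
    using assms by (simp add: commutator_def inv_mult_group m_assoc)
  then show ?thesis using assms inv_mult_eq_one_iff[of "y \<otimes> x" "x \<otimes> y"] by auto
qed

end

lemma (in group_hom) hom_commutator:
  "\<lbrakk>x \<in> carrier G; y \<in> carrier G\<rbrakk> \<Longrightarrow> h (commutator G x y) = commutator H (h x) (h y)"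
  by (simp add: commutator_def)

text \<open>
  The quotient of \<open>Z\<^sub>i\<^sub>+\<^sub>1\<close> by \<open>Z\<^sub>i\<close> is the centre of \<open>G\<close> modulo \<open>Z\<^sub>i\<close>. Every argument
  by induction along the series uses the series only through this fact.
\<close>

lemma (in group) mem_upper_central_Suc_iff:
  assumes "group_hom G Q h" "h ` carrier G = carrier Q"
    and "\<forall>x \<in> carrier G. h x = \<one>\<^bsub>Q\<^esub> \<longleftrightarrow> x \<in> upper_central G i"
    and x: "x \<in> carrier G"
  shows "x \<in> upper_central G (Suc i) \<longleftrightarrow> (\<forall>q \<in> carrier Q. h x \<otimes>\<^bsub>Q\<^esub> q = q \<otimes>\<^bsub>Q\<^esub> h x)"
proof -
  interpret h: group_hom G Q h by (rule assms(1))
  have "commutator G x g \<in> upper_central G i \<longleftrightarrow> h x \<otimes>\<^bsub>Q\<^esub> h g = h g \<otimes>\<^bsub>Q\<^esub> h x"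
    if "g \<in> carrier G" for g
    using bspec[OF assms(3), of "commutator G x g"] x that
    by (simp add: h.hom_commutator h.H.commutator_eq_one_iff)
  then show ?thesis using x by (auto simp flip: assms(2))
qed

lemma (in group) upper_central_SucD:
  assumes "group_hom G Q h" "h ` carrier G = carrier Q"
    and "\<forall>x \<in> carrier G. h x = \<one>\<^bsub>Q\<^esub> \<longleftrightarrow> x \<in> upper_central G i"
    and x: "x \<in> upper_central G (Suc i)" and q: "q \<in> carrier Q"
  shows "h x \<otimes>\<^bsub>Q\<^esub> q = q \<otimes>\<^bsub>Q\<^esub> h x"
proof -
  have "x \<in> carrier G" using x upper_central_carrier by blast
  from mem_upper_central_Suc_iff[OF assms(1-3) this] x q show ?thesis by blast
qed

section \<open>Torsion and roots in nilpotent groups\<close>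

context group
begin

lemma pow_conjugate:
  assumes "x \<in> carrier G" "g \<in> carrier G"
  shows "(inv g \<otimes> x \<otimes> g) [^] (n::nat) = inv g \<otimes> x [^] n \<otimes> g"
  using assms by (induction n) (simp_all add: m_assoc cancel_simps)

text \<open>
  All factors of the upper central series are torsion-free once the centre is. Let \<open>x\<close> lie in
  \<open>Z\<^sub>i\<^sub>+\<^sub>2\<close> and \<open>x\<^sup>n\<close> in \<open>Z\<^sub>i\<^sub>+\<^sub>1\<close>. Modulo \<open>Z\<^sub>i\<close> the commutator \<open>[x, g]\<close> is central, so the
  \<open>n\<close>-th power of \<open>g\<inverse> x g = x [x, g]\<close> is \<open>x\<^sup>n [x, g]\<^sup>n\<close>; it is also the conjugate of the central
  element \<open>x\<^sup>n\<close>. Hence \<open>[x, g]\<^sup>n\<close> lies in \<open>Z\<^sub>i\<close>, by induction so does \<open>[x, g]\<close>, and therefore \<open>x\<close> lies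
  in \<open>Z\<^sub>i\<^sub>+\<^sub>1\<close>.
\<close>

lemma upper_central_torsion_free_step:
  assumes centre: "\<forall>x \<in> upper_central G 1. \<forall>n \<ge> (1::nat). x [^] n = \<one> \<longrightarrow> x = \<one>"
    and "n \<ge> (1::nat)" "x \<in> upper_central G (Suc i)" "x [^] n \<in> upper_central G i"
  shows "x \<in> upper_central G i"
  using assms(3,4)
proof (induction i arbitrary: x)
  case 0
  then have "x [^] n = \<one>" by simp
  with 0(1) have "x = \<one>" using centre assms(2) by (metis One_nat_def)
  then show ?case by simp
next
  case (Suc i)
  have x: "x \<in> carrier G" using Suc.prems by simp
  obtain Q :: "'a set monoid" and h where h: "group_hom G Q h" "h ` carrier G = carrier Q"
    and ker: "\<forall>x \<in> carrier G. h x = \<one>\<^bsub>Q\<^esub> \<longleftrightarrow> x \<in> upper_central G i"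
    using normal_quotient_hom[OF upper_central_normal[of i]] by blast
  interpret h: group_hom G Q h by (rule h)
  note comm = upper_central_SucD[OF h ker]
  have "commutator G x g \<in> upper_central G i" if g: "g \<in> carrier G" for g
  proof (rule Suc.IH)
    let ?y = "commutator G x g"
    show y: "?y \<in> upper_central G (Suc i)"
      using Suc.prems(1) g by simp
    have xy: "x \<otimes> ?y = inv g \<otimes> x \<otimes> g"
      using x g by (simp add: commutator_def m_assoc cancel_simps)
    have "h (x \<otimes> ?y) [^]\<^bsub>Q\<^esub> n = h ((x \<otimes> ?y) [^] n)"
      using x g by (simp only: h.hom_nat_pow m_closed commutator_closed)
    also have "\<dots> = h (inv g \<otimes> x [^] n \<otimes> g)"
      unfolding xy using x g by (simp only: pow_conjugate)
    also have "\<dots> = inv\<^bsub>Q\<^esub> (h g) \<otimes>\<^bsub>Q\<^esub> (h (x [^] n) \<otimes>\<^bsub>Q\<^esub> h g)"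
      using x g by (simp add: h.H.m_assoc)
    also have "h (x [^] n) \<otimes>\<^bsub>Q\<^esub> h g = h g \<otimes>\<^bsub>Q\<^esub> h (x [^] n)"
      using Suc.prems(2) g by (intro comm) simp_all
    also have "inv\<^bsub>Q\<^esub> (h g) \<otimes>\<^bsub>Q\<^esub> (h g \<otimes>\<^bsub>Q\<^esub> h (x [^] n)) = h x [^]\<^bsub>Q\<^esub> n"
      using x g by (simp add: h.H.cancel_simps h.hom_nat_pow)
    finally have "(h x \<otimes>\<^bsub>Q\<^esub> h ?y) [^]\<^bsub>Q\<^esub> n = h x [^]\<^bsub>Q\<^esub> n"
      using x g by simp
    moreover have "(h x \<otimes>\<^bsub>Q\<^esub> h ?y) [^]\<^bsub>Q\<^esub> n = h x [^]\<^bsub>Q\<^esub> n \<otimes>\<^bsub>Q\<^esub> h ?y [^]\<^bsub>Q\<^esub> n"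
      by (intro h.H.pow_mult_distrib comm[OF y, symmetric] h.hom_closed x commutator_closed g)
    ultimately have "h (?y [^] n) = \<one>\<^bsub>Q\<^esub>"
      using x g by (simp add: h.hom_nat_pow)
    then show "?y [^] n \<in> upper_central G i"
      using bspec[OF ker, of "?y [^] n"] x g by simp
  qed
  then show ?case using x by simp
qed

text \<open>
  Let \<open>a\<^sup>n = b\<^sup>n\<close> and \<open>b = a w\<close>. If \<open>w\<close> lies in \<open>Z\<^sub>i\<^sub>+\<^sub>1\<close>, then it is central modulo \<open>Z\<^sub>i\<close>, so
  \<open>b\<^sup>n = a\<^sup>n w\<^sup>n\<close> there and \<open>w\<^sup>n\<close> lies in \<open>Z\<^sub>i\<close>. As the factors are torsion-free, \<open>w\<close> itself lies in
  \<open>Z\<^sub>i\<close>. In this way \<open>w\<close> descends from \<open>Z\<^sub>c = G\<close> to \<open>Z\<^sub>0\<close>.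
\<close>

lemma nilpotent_unique_roots:
  assumes centre: "\<forall>x \<in> upper_central G 1. \<forall>n \<ge> (1::nat). x [^] n = \<one> \<longrightarrow> x = \<one>"
    and nil: "nilpotent_group c G"
  shows "unique_roots G"
  unfolding unique_roots_def
proof (intro ballI allI impI)
  fix a b and n :: nat
  assume a: "a \<in> carrier G" and b: "b \<in> carrier G" and n: "n \<ge> 1" and eq: "a [^] n = b [^] n"
  have "inv a \<otimes> b \<in> upper_central G (c - k)" for k
  proof (induction k)
    case 0
    then show ?case using nil a b by (simp add: nilpotent_group_iff_upper_central)
  next
    case (Suc k)
    show ?case
    proof (cases "c - k")
      case 0
      then show ?thesis using Suc by simp
    next
      case (Suc i)
      obtain Q :: "'a set monoid" and h where h: "group_hom G Q h" "h ` carrier G = carrier Q"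
        and ker: "\<forall>x \<in> carrier G. h x = \<one>\<^bsub>Q\<^esub> \<longleftrightarrow> x \<in> upper_central G i"
        using normal_quotient_hom[OF upper_central_normal[of i]] by blast
      interpret h: group_hom G Q h by (rule h)
      let ?w = "inv a \<otimes> b"
      have w: "?w \<in> upper_central G (Suc i)"
        using Suc.IH \<open>c - k = Suc i\<close> by simp
      have comm: "h a \<otimes>\<^bsub>Q\<^esub> h ?w = h ?w \<otimes>\<^bsub>Q\<^esub> h a"
        using upper_central_SucD[OF h ker w] a by simp
      have "b = a \<otimes> ?w" using a b by (simp add: cancel_simps)
      then have "h b [^]\<^bsub>Q\<^esub> n = (h a \<otimes>\<^bsub>Q\<^esub> h ?w) [^]\<^bsub>Q\<^esub> n"
        using a b by (metis h.hom_mult inv_closed m_closed)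
      also have "\<dots> = h a [^]\<^bsub>Q\<^esub> n \<otimes>\<^bsub>Q\<^esub> h ?w [^]\<^bsub>Q\<^esub> n"
        using comm a b by (intro h.H.pow_mult_distrib) auto
      finally have "h b [^]\<^bsub>Q\<^esub> n = h a [^]\<^bsub>Q\<^esub> n \<otimes>\<^bsub>Q\<^esub> h (?w [^] n)"
        using a b by (simp only: h.hom_nat_pow m_closed inv_closed)
      moreover have "h b [^]\<^bsub>Q\<^esub> n = h a [^]\<^bsub>Q\<^esub> n"
        using a b eq by (simp flip: h.hom_nat_pow)
      ultimately have "h (?w [^] n) = \<one>\<^bsub>Q\<^esub>"
        using h.H.r_cancel_one[of "h a [^]\<^bsub>Q\<^esub> n" "h (?w [^] n)"] a b by simp
      then have "?w [^] n \<in> upper_central G i"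
        using bspec[OF ker, of "?w [^] n"] a b by simp
      then have "?w \<in> upper_central G i"
        using upper_central_torsion_free_step[OF centre n w] by blast
      moreover have "c - Suc k = i" using \<open>c - k = Suc i\<close> by simp
      ultimately show ?thesis by simp
    qed
  qed
  from this[of c] show "a = b"
    using a b by (simp add: inv_mult_eq_one_iff)
qed

lemma unique_roots_imp_torsion_free: "unique_roots G \<Longrightarrow> torsion_free G"
  by (force simp: unique_roots_def torsion_free_def)

end

section \<open>The terms defining nilpotency of monoids\<close>

lemma (in monoid) q_term_closed:
  assumes "x \<in> carrier G" "y \<in> carrier G" "z \<in> UNIV \<rightarrow> carrier G"
  shows "q_term G (Suc k) x y z \<in> carrier G"
  using assms(1,2)
proof (induction k arbitrary: x y)
  case (Suc k)
  moreover have "z (Suc k) \<in> carrier G" using assms(3) by blast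
  ultimately show ?case by simp
qed simp

lemma q_term_cong:
  assumes "\<And>i. i \<le> k \<Longrightarrow> z i = z' i"
  shows "q_term M (Suc k) x y z = q_term M (Suc k) x y z'"
  using assms by (induction k arbitrary: x y) auto

lemma q_term_hom:
  assumes "monoid M" and f: "f \<in> hom M N"
    and xy: "x \<in> carrier M" "y \<in> carrier M" and z: "z \<in> UNIV \<rightarrow> carrier M"
  shows "f (q_term M (Suc k) x y z) = q_term N (Suc k) (f x) (f y) (f \<circ> z)"
  using xy
proof (induction k arbitrary: x y)
  case 0
  then show ?case using hom_mult[OF f] by simp
next
  case (Suc k)
  have "z (Suc k) \<in> carrier M" using z by blast
  then show ?case
    using Suc monoid.q_term_closed[OF assms(1) _ _ z] monoid.m_closed[OF assms(1)]
    by (simp add: hom_mult[OF f])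
qed

lemma q_term_submonoid: "q_term (M\<lparr>carrier := H\<rparr>) (Suc k) x y z = q_term M (Suc k) x y z"
  by (induction k arbitrary: x y) simp_all

section \<open>Nilpotency of a group and the monoid laws\<close>

context group
begin

lemma commute_quotient:
  assumes "p \<in> carrier G" "a \<in> carrier G" "b \<in> carrier G" "p \<otimes> a = a \<otimes> p" "p \<otimes> b = b \<otimes> p"
  shows "p \<otimes> (inv a \<otimes> b) = (inv a \<otimes> b) \<otimes> p"
proof -
  have "p \<otimes> inv a = inv a \<otimes> (a \<otimes> p) \<otimes> inv a"
    using assms(1-3) by (simp add: m_assoc cancel_simps)
  also have "\<dots> = inv a \<otimes> p"
    using assms(1-3) by (simp flip: assms(4) add: m_assoc)
  finally have "p \<otimes> (inv a \<otimes> b) = inv a \<otimes> (p \<otimes> b)"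
    using assms(1-3) by (simp flip: m_assoc)
  then show ?thesis using assms by (simp add: m_assoc)
qed

text \<open>
  This is the content of one step of the recursion for the terms \<open>q\<close>. The choice \<open>w = \<one>\<close> shows
  that \<open>u\<close> and \<open>v\<close> commute, and then \<open>v\<inverse> u w = v\<inverse> (u w v) v\<inverse> = w u v\<inverse> = w (v\<inverse> u)\<close> for
  all \<open>w\<close> in \<open>K\<close>.
\<close>

lemma central_of_swap:
  assumes u: "u \<in> carrier G" and v: "v \<in> carrier G"
    and K: "K \<subseteq> carrier G" "\<one> \<in> K"
    and gen: "\<And>g. g \<in> carrier G \<Longrightarrow> \<exists>a \<in> K. \<exists>b \<in> K. g = inv a \<otimes> b"
    and swap: "\<And>w. w \<in> K \<Longrightarrow> u \<otimes> w \<otimes> v = v \<otimes> w \<otimes> u"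
    and g: "g \<in> carrier G"
  shows "(inv v \<otimes> u) \<otimes> g = g \<otimes> (inv v \<otimes> u)"
proof -
  have uv: "u \<otimes> v = v \<otimes> u" using swap[OF K(2)] u v by simp
  have K_comm: "(inv v \<otimes> u) \<otimes> w = w \<otimes> (inv v \<otimes> u)" if w: "w \<in> K" for w
  proof -
    have wc: "w \<in> carrier G" using w K by blast
    have "u \<otimes> inv v = inv v \<otimes> (v \<otimes> u) \<otimes> inv v"
      using u v by (simp add: m_assoc cancel_simps)
    also have "\<dots> = inv v \<otimes> u" unfolding uv[symmetric] using u v by (simp add: m_assoc)
    finally have uv': "u \<otimes> inv v = inv v \<otimes> u" .
    have "(inv v \<otimes> u) \<otimes> w = inv v \<otimes> (u \<otimes> w \<otimes> v) \<otimes> inv v"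
      using u v wc by (simp add: m_assoc cancel_simps)
    also have "\<dots> = w \<otimes> (u \<otimes> inv v)"
      unfolding swap[OF w] using u v wc by (simp add: m_assoc cancel_simps)
    finally show ?thesis unfolding uv' .
  qed
  obtain a b where "a \<in> K" "b \<in> K" "g = inv a \<otimes> b" using gen[OF g] by blast
  then show ?thesis using commute_quotient[of "inv v \<otimes> u" a b] K_comm K u v by blast
qed

text \<open>
  The term \<open>q\<close> of index \<open>j + 1\<close> is \<open>u z v\<close>, where \<open>u\<close> and \<open>v\<close> are the terms of index \<open>j\<close> for
  \<open>(x, y)\<close> and \<open>(y, x)\<close>, and \<open>z\<close> is a variable that occurs in neither. If the law of index
  \<open>j + 1\<close> holds on \<open>H\<close> modulo \<open>Z\<^sub>i\<close>, then \<open>u z v\<close> and \<open>v z u\<close> agree there for all \<open>z\<close> in \<open>H\<close>, and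
  \<open>central_of_swap\<close> puts \<open>v\<inverse> u\<close> into \<open>Z\<^sub>i\<^sub>+\<^sub>1\<close>: the law of index \<open>j\<close> holds on \<open>H\<close> modulo
  \<open>Z\<^sub>i\<^sub>+\<^sub>1\<close>. Starting with the given law modulo \<open>Z\<^sub>0\<close>, one reaches commutativity of \<open>H\<close>, and hence of
  \<open>G\<close>, modulo \<open>Z\<^sub>k\<close>.
\<close>

lemma nilpotent_of_generating_submonoid:
  assumes H: "submonoid H G"
    and gen: "\<And>g. g \<in> carrier G \<Longrightarrow> \<exists>a \<in> H. \<exists>b \<in> H. g = inv a \<otimes> b"
    and nil: "nilpotent_monoid (Suc k) (G\<lparr>carrier := H\<rparr>)"
  shows "nilpotent_group (Suc k) G"
proof -
  have Hc: "H \<subseteq> carrier G" and H1: "\<one> \<in> H"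
    using H by (auto simp: submonoid_def)
  have q_closed: "q_term G (Suc j) x y z \<in> carrier G"
    if "x \<in> H" "y \<in> H" "z \<in> UNIV \<rightarrow> H" for j x y z
    using that Hc by (intro q_term_closed) auto
  let ?d = "\<lambda>j x y z. inv (q_term G (Suc j) y x z) \<otimes> q_term G (Suc j) x y z"
  have *: "\<forall>x \<in> H. \<forall>y \<in> H. \<forall>z \<in> UNIV \<rightarrow> H. ?d (k - i) x y z \<in> upper_central G i"
    if "i \<le> k" for i
    using that
  proof (induction i)
    case 0
    then show ?case
      using nil q_closed by (auto simp: nilpotent_monoid_def q_term_submonoid)
  next
    case (Suc i)
    define j where "j = k - Suc i"
    have j: "k - i = Suc j" using Suc.prems by (simp add: j_def)
    obtain Q :: "'a set monoid" and h where h: "group_hom G Q h" "h ` carrier G = carrier Q"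
      and ker: "\<forall>x \<in> carrier G. h x = \<one>\<^bsub>Q\<^esub> \<longleftrightarrow> x \<in> upper_central G i"
      using normal_quotient_hom[OF upper_central_normal[of i]] by blast
    interpret h: group_hom G Q h by (rule h)
    show ?case unfolding j_def[symmetric]
    proof (intro ballI)
      fix x y and z :: "nat \<Rightarrow> 'a" assume xyz: "x \<in> H" "y \<in> H" "z \<in> UNIV \<rightarrow> H"
      define u where "u = q_term G (Suc j) x y z"
      define v where "v = q_term G (Suc j) y x z"
      have uv: "u \<in> carrier G" "v \<in> carrier G" using q_closed xyz by (auto simp: u_def v_def)
      have swap: "h u \<otimes>\<^bsub>Q\<^esub> h w \<otimes>\<^bsub>Q\<^esub> h v = h v \<otimes>\<^bsub>Q\<^esub> h w \<otimes>\<^bsub>Q\<^esub> h u" if w: "w \<in> H" for w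
      proof -
        \<comment> \<open>The variable of index \<open>j + 1\<close> is the middle factor and does not occur in \<open>u\<close> and \<open>v\<close>.\<close>
        let ?z = "z(Suc j := w)"
        have wc: "w \<in> carrier G" using w Hc by blast
        have "?z \<in> UNIV \<rightarrow> H" using xyz(3) w by auto
        then have "?d (Suc j) x y ?z \<in> upper_central G i"
          using Suc xyz j by (metis Suc_leD)
        moreover have "q_term G (Suc j) a b ?z = q_term G (Suc j) a b z" for a b
          by (rule q_term_cong) simp
        ultimately have "inv (v \<otimes> w \<otimes> u) \<otimes> (u \<otimes> w \<otimes> v) \<in> upper_central G i"
          by (simp add: u_def v_def)
        then have "h (inv (v \<otimes> w \<otimes> u) \<otimes> (u \<otimes> w \<otimes> v)) = \<one>\<^bsub>Q\<^esub>"
          using bspec[OF ker, of "inv (v \<otimes> w \<otimes> u) \<otimes> (u \<otimes> w \<otimes> v)"] uv wc by simp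
        then have "inv\<^bsub>Q\<^esub> (h v \<otimes>\<^bsub>Q\<^esub> h w \<otimes>\<^bsub>Q\<^esub> h u) \<otimes>\<^bsub>Q\<^esub> (h u \<otimes>\<^bsub>Q\<^esub> h w \<otimes>\<^bsub>Q\<^esub> h v) = \<one>\<^bsub>Q\<^esub>"
          using uv wc by simp
        then show ?thesis
          using uv wc h.H.inv_mult_eq_one_iff[of "h v \<otimes>\<^bsub>Q\<^esub> h w \<otimes>\<^bsub>Q\<^esub> h u" "h u \<otimes>\<^bsub>Q\<^esub> h w \<otimes>\<^bsub>Q\<^esub> h v"]
          by simp
      qed
      have gen_Q: "\<exists>a \<in> h ` H. \<exists>b \<in> h ` H. q = inv\<^bsub>Q\<^esub> a \<otimes>\<^bsub>Q\<^esub> b" if q: "q \<in> carrier Q" for q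
      proof -
        obtain g where "g \<in> carrier G" "q = h g" using q h(2) by blast
        moreover from this obtain a b where "a \<in> H" "b \<in> H" "g = inv a \<otimes> b" using gen by blast
        ultimately have "q = inv\<^bsub>Q\<^esub> (h a) \<otimes>\<^bsub>Q\<^esub> h b" using Hc by (auto simp: subset_iff)
        then show ?thesis using \<open>a \<in> H\<close> \<open>b \<in> H\<close> by blast
      qed
      have "(inv\<^bsub>Q\<^esub> h v \<otimes>\<^bsub>Q\<^esub> h u) \<otimes>\<^bsub>Q\<^esub> q = q \<otimes>\<^bsub>Q\<^esub> (inv\<^bsub>Q\<^esub> h v \<otimes>\<^bsub>Q\<^esub> h u)" if "q \<in> carrier Q" for q
      proof (rule h.H.central_of_swap[where K = "h ` H"])
        show "\<one>\<^bsub>Q\<^esub> \<in> h ` H" using H1 h.hom_one by (metis imageI)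
      qed (use uv Hc gen_Q swap that in auto)
      then have "inv v \<otimes> u \<in> upper_central G (Suc i)"
        using uv mem_upper_central_Suc_iff[OF h ker, of "inv v \<otimes> u"] by simp
      then show "?d j x y z \<in> upper_central G (Suc i)" by (simp add: u_def v_def)
    qed
  qed
  obtain Q :: "'a set monoid" and h where h: "group_hom G Q h" "h ` carrier G = carrier Q"
    and ker: "\<forall>x \<in> carrier G. h x = \<one>\<^bsub>Q\<^esub> \<longleftrightarrow> x \<in> upper_central G k"
    using normal_quotient_hom[OF upper_central_normal[of k]] by blast
  interpret h: group_hom G Q h by (rule h)
  have HH: "h x \<otimes>\<^bsub>Q\<^esub> h y = h y \<otimes>\<^bsub>Q\<^esub> h x" if "x \<in> H" "y \<in> H" for x y
  proof -
    have xy: "x \<in> carrier G" "y \<in> carrier G" using that Hc by auto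
    have "?d 0 x y (\<lambda>_. \<one>) \<in> upper_central G k"
      using *[of k, simplified diff_self_eq_0] that H1 by (metis Pi_I le_refl)
    then have "inv (y \<otimes> x) \<otimes> (x \<otimes> y) \<in> upper_central G k" by simp
    then have "h (inv (y \<otimes> x) \<otimes> (x \<otimes> y)) = \<one>\<^bsub>Q\<^esub>"
      using bspec[OF ker, of "inv (y \<otimes> x) \<otimes> (x \<otimes> y)"] xy by simp
    then show ?thesis
      using xy h.H.inv_mult_eq_one_iff[of "h y \<otimes>\<^bsub>Q\<^esub> h x" "h x \<otimes>\<^bsub>Q\<^esub> h y"] by simp
  qed
  have HG: "h x \<otimes>\<^bsub>Q\<^esub> h g = h g \<otimes>\<^bsub>Q\<^esub> h x" if x: "x \<in> carrier G" and g: "g \<in> carrier G"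
    and comm: "\<And>y. y \<in> H \<Longrightarrow> h x \<otimes>\<^bsub>Q\<^esub> h y = h y \<otimes>\<^bsub>Q\<^esub> h x" for x g
  proof -
    obtain a b where ab: "a \<in> H" "b \<in> H" "g = inv a \<otimes> b" using gen[OF g] by blast
    then show ?thesis
      using h.H.commute_quotient[of "h x" "h a" "h b"] comm x Hc by (auto simp: subset_iff)
  qed
  have "x \<in> upper_central G (Suc k)" if x: "x \<in> carrier G" for x
  proof -
    have "h x \<otimes>\<^bsub>Q\<^esub> h g = h g \<otimes>\<^bsub>Q\<^esub> h x" if g: "g \<in> carrier G" for g
      using HG[OF x g] HG[OF _ x] HH Hc by (metis subsetD)
    then show ?thesis
      using mem_upper_central_Suc_iff[OF h ker x] by (simp flip: h(2))
  qed
  then show ?thesis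
    using nilpotent_group_iff_upper_central upper_central_carrier by blast
qed

text \<open>
  The same correspondence between the index of the law and the member of the upper central series,
  read in the other direction: if \<open>u\<close> and \<open>v\<close> differ by a factor \<open>p\<close> that is central modulo \<open>Z\<^sub>i\<close>,
  then \<open>u w v = v p w v\<close> and \<open>v w u = v w v p\<close> agree modulo \<open>Z\<^sub>i\<close>.
\<close>

lemma nilpotent_group_imp_nilpotent_monoid:
  assumes "nilpotent_group (Suc k) G"
  shows "nilpotent_monoid (Suc k) G"
proof -
  let ?d = "\<lambda>j x y z. inv (q_term G (Suc j) y x z) \<otimes> q_term G (Suc j) x y z"
  have "\<forall>x \<in> carrier G. \<forall>y \<in> carrier G. \<forall>z \<in> UNIV \<rightarrow> carrier G. ?d j x y z \<in> upper_central G (k - j)"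
    if "j \<le> k" for j
    using that
  proof (induction j)
    case 0
    show ?case
    proof (intro ballI)
      fix x y and z :: "nat \<Rightarrow> 'a" assume xy: "x \<in> carrier G" "y \<in> carrier G"
      have "x \<in> upper_central G (Suc k)"
        using assms xy by (simp only: nilpotent_group_iff_upper_central)
      then have "commutator G x y \<in> upper_central G k" using xy by simp
      then show "?d 0 x y z \<in> upper_central G (k - 0)"
        using xy by (simp add: commutator_def inv_mult_group m_assoc)
    qed
  next
    case (Suc j)
    define i where "i = k - Suc j"
    have i: "k - j = Suc i" using Suc.prems by (simp add: i_def)
    obtain Q :: "'a set monoid" and h where h: "group_hom G Q h" "h ` carrier G = carrier Q"
      and ker: "\<forall>x \<in> carrier G. h x = \<one>\<^bsub>Q\<^esub> \<longleftrightarrow> x \<in> upper_central G i"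
      using normal_quotient_hom[OF upper_central_normal[of i]] by blast
    interpret h: group_hom G Q h by (rule h)
    show ?case unfolding i_def[symmetric]
    proof (intro ballI)
      fix x y and z :: "nat \<Rightarrow> 'a" assume xyz: "x \<in> carrier G" "y \<in> carrier G" "z \<in> UNIV \<rightarrow> carrier G"
      define u where "u = q_term G (Suc j) x y z"
      define v where "v = q_term G (Suc j) y x z"
      define w where "w = z (Suc j)"
      have c: "u \<in> carrier G" "v \<in> carrier G" "w \<in> carrier G"
        using q_term_closed xyz by (auto simp: u_def v_def w_def)
      let ?p = "inv v \<otimes> u"
      have "?p \<in> upper_central G (Suc i)"
        using Suc xyz i by (simp add: u_def v_def)
      note comm = upper_central_SucD[OF h ker this]
      have u: "h u = h v \<otimes>\<^bsub>Q\<^esub> h ?p" using c by (simp add: h.H.cancel_simps)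
      have "h u \<otimes>\<^bsub>Q\<^esub> h w \<otimes>\<^bsub>Q\<^esub> h v = h v \<otimes>\<^bsub>Q\<^esub> (h ?p \<otimes>\<^bsub>Q\<^esub> (h w \<otimes>\<^bsub>Q\<^esub> h v))"
        unfolding u using c by (simp only: h.H.m_assoc h.H.m_closed h.hom_closed m_closed inv_closed)
      also have "h ?p \<otimes>\<^bsub>Q\<^esub> (h w \<otimes>\<^bsub>Q\<^esub> h v) = (h w \<otimes>\<^bsub>Q\<^esub> h v) \<otimes>\<^bsub>Q\<^esub> h ?p"
        using c by (intro comm) simp
      also have "h v \<otimes>\<^bsub>Q\<^esub> ((h w \<otimes>\<^bsub>Q\<^esub> h v) \<otimes>\<^bsub>Q\<^esub> h ?p) = h v \<otimes>\<^bsub>Q\<^esub> h w \<otimes>\<^bsub>Q\<^esub> h u"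
        unfolding u using c by (simp only: h.H.m_assoc h.H.m_closed h.hom_closed m_closed inv_closed)
      finally have "h (u \<otimes> w \<otimes> v) = h (v \<otimes> w \<otimes> u)" using c by simp
      then have "h (inv (v \<otimes> w \<otimes> u) \<otimes> (u \<otimes> w \<otimes> v)) = \<one>\<^bsub>Q\<^esub>"
        using c by simp
      then have "inv (v \<otimes> w \<otimes> u) \<otimes> (u \<otimes> w \<otimes> v) \<in> upper_central G i"
        using bspec[OF ker, of "inv (v \<otimes> w \<otimes> u) \<otimes> (u \<otimes> w \<otimes> v)"] c by simp
      then show "?d (Suc j) x y z \<in> upper_central G i"
        by (simp add: u_def v_def w_def)
    qed
  qed
  from this[of k] have "?d k x y z = \<one>"
    if "x \<in> carrier G" "y \<in> carrier G" "z \<in> UNIV \<rightarrow> carrier G" for x y z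
    using that by simp
  then have "q_term G (Suc k) x y z = q_term G (Suc k) y x z"
    if "x \<in> carrier G" "y \<in> carrier G" "z \<in> UNIV \<rightarrow> carrier G" for x y z
    using that inv_mult_eq_one_iff[OF q_term_closed q_term_closed] by (metis (no_types))
  then show ?thesis
    unfolding nilpotent_monoid_def using is_monoid by blast
qed

text \<open>
  If \<open>x = a\<inverse> b\<close> is central, then \<open>b = a x\<close> commutes with \<open>a\<close>, and \<open>x\<^sup>n = \<one>\<close> gives
  \<open>b\<^sup>n = a\<^sup>n x\<^sup>n = a\<^sup>n\<close>. So torsion in the centre is excluded by a statement about commuting elements
  of \<open>H\<close> alone.
\<close>

lemma centre_torsion_free_of_commuting_roots:
  assumes H: "submonoid H G"
    and gen: "\<And>g. g \<in> carrier G \<Longrightarrow> \<exists>a \<in> H. \<exists>b \<in> H. g = inv a \<otimes> b"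
    and roots: "\<And>a b n. \<lbrakk>a \<in> H; b \<in> H; a \<otimes> b = b \<otimes> a; n \<ge> (1::nat); a [^] n = b [^] n\<rbrakk> \<Longrightarrow> a = b"
  shows "\<forall>x \<in> upper_central G 1. \<forall>n \<ge> (1::nat). x [^] n = \<one> \<longrightarrow> x = \<one>"
proof (intro ballI allI impI)
  fix x and n :: nat
  assume x: "x \<in> upper_central G 1" and n: "n \<ge> 1" "x [^] n = \<one>"
  have xc: "x \<in> carrier G" using x upper_central_carrier by blast
  have central: "x \<otimes> g = g \<otimes> x" if "g \<in> carrier G" for g
    using x that xc by (simp add: commutator_eq_one_iff)
  obtain a b where ab: "a \<in> H" "b \<in> H" "x = inv a \<otimes> b" using gen[OF xc] by blast
  have c: "a \<in> carrier G" "b \<in> carrier G" using ab H by (auto simp: submonoid_def)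
  have b: "b = a \<otimes> x" using ab c by (simp add: cancel_simps)
  have "b [^] n = a [^] n \<otimes> x [^] n"
    unfolding b using central[of a] c xc by (intro pow_mult_distrib) auto
  then have "a [^] n = b [^] n" using n c by simp
  moreover have "a \<otimes> b = b \<otimes> a"
    unfolding b using central[of a] c xc by (simp add: m_assoc)
  ultimately have "a = b" using roots ab n by blast
  then show "x = \<one>" using ab c by simp
qed

end

section \<open>Submonoids and groups of quotients up to isomorphism\<close>

text \<open>
  A homomorphism is only required to respect products; surjectivity forces it to respect the unit.
\<close>

lemma iso_monoid_one:
  assumes "monoid M" "monoid N" "f \<in> iso M N"
  shows "f \<one>\<^bsub>M\<^esub> = \<one>\<^bsub>N\<^esub>"
proof -
  interpret M: monoid M by fact
  interpret N: monoid N by fact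
  have hom: "f \<in> hom M N" and surj: "f ` carrier M = carrier N"
    using assms(3) by (auto simp: iso_iff)
  obtain x where x: "x \<in> carrier M" "f x = \<one>\<^bsub>N\<^esub>" using surj N.one_closed by (metis imageE)
  have "f \<one>\<^bsub>M\<^esub> = f \<one>\<^bsub>M\<^esub> \<otimes>\<^bsub>N\<^esub> f x" using x hom by (simp add: hom_in_carrier)
  also have "\<dots> = f x" using hom_mult[OF hom M.one_closed x(1)] x by simp
  finally show ?thesis using x by simp
qed

lemma submonoid_ofE:
  assumes "monoid M" "monoid B" "submonoid_of M B"
  obtains f where "f \<in> mon M B" "f \<one>\<^bsub>M\<^esub> = \<one>\<^bsub>B\<^esub>"
proof -
  obtain H f where H: "submonoid H B" and f: "f \<in> iso M (B\<lparr>carrier := H\<rparr>)"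
    using assms(3) by (auto simp: submonoid_of_def is_iso_def)
  have "f \<in> mon M B"
    using f submonoid.subset[OF H] by (auto simp: mon_def iso_iff hom_def)
  moreover have "f \<one>\<^bsub>M\<^esub> = \<one>\<^bsub>B\<^esub>"
    using iso_monoid_one[OF assms(1) _ f] submonoid.submonoid_is_monoid[OF H assms(2)] by simp
  ultimately show ?thesis by (rule that)
qed

lemma mon_image_submonoid:
  assumes M: "monoid M" and f: "f \<in> mon M B" and one: "f \<one>\<^bsub>M\<^esub> = \<one>\<^bsub>B\<^esub>"
  shows "submonoid (f ` carrier M) B" "M \<cong> B\<lparr>carrier := f ` carrier M\<rparr>"
proof -
  have hom: "f \<in> hom M B" using f by (simp add: mon_def)
  show "submonoid (f ` carrier M) B"
  proof
    show "f ` carrier M \<subseteq> carrier B" using hom by (auto simp: hom_def)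
    show "\<one>\<^bsub>B\<^esub> \<in> f ` carrier M" using one monoid.one_closed[OF M] by (metis imageI)
    show "x \<otimes>\<^bsub>B\<^esub> y \<in> f ` carrier M" if "x \<in> f ` carrier M" "y \<in> f ` carrier M" for x y
      using that monoid.m_closed[OF M] by (auto simp flip: hom_mult[OF hom])
  qed
  have "f \<in> iso M (B\<lparr>carrier := f ` carrier M\<rparr>)"
    using f by (auto simp: mon_def iso_iff hom_def)
  then show "M \<cong> B\<lparr>carrier := f ` carrier M\<rparr>" by (rule is_isoI)
qed

lemma nilpotent_monoid_mon:
  assumes M: "monoid M" and f: "f \<in> mon M B" and nil: "nilpotent_monoid (Suc k) B"
  shows "nilpotent_monoid (Suc k) M"
  unfolding nilpotent_monoid_def
proof (intro conjI ballI M)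
  have hom: "f \<in> hom M B" and inj: "inj_on f (carrier M)" using f by (auto simp: mon_def)
  fix x y and z :: "nat \<Rightarrow> 'a"
  assume xyz: "x \<in> carrier M" "y \<in> carrier M" "z \<in> UNIV \<rightarrow> carrier M"
  have "f \<circ> z \<in> UNIV \<rightarrow> carrier B" using xyz(3) hom by (auto simp: hom_def)
  then have "q_term B (Suc k) (f x) (f y) (f \<circ> z) = q_term B (Suc k) (f y) (f x) (f \<circ> z)"
    using nil xyz hom_in_carrier[OF hom] unfolding nilpotent_monoid_def by blast
  then have "f (q_term M (Suc k) x y z) = f (q_term M (Suc k) y x z)"
    using xyz by (simp only: q_term_hom[OF M hom])
  then show "q_term M (Suc k) x y z = q_term M (Suc k) y x z"
    using inj_onD[OF inj] monoid.q_term_closed[OF M] xyz by blast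
qed

lemma monoid_cancel_mon:
  assumes M: "monoid M" and f: "f \<in> mon M B" and B: "monoid_cancel B"
  shows "monoid_cancel M"
proof -
  interpret M: monoid M by fact
  interpret B: monoid_cancel B by fact
  have hom: "f \<in> hom M B" and inj: "inj_on f (carrier M)" using f by (auto simp: mon_def)
  note mult = hom_mult[OF hom] and closed = hom_in_carrier[OF hom]
  show ?thesis
  proof
    fix a b c assume c: "a \<in> carrier M" "b \<in> carrier M" "c \<in> carrier M"
    show "a = b" if "c \<otimes>\<^bsub>M\<^esub> a = c \<otimes>\<^bsub>M\<^esub> b"
      using that c mult closed B.l_cancel inj by (metis inj_onD)
    show "a = b" if "a \<otimes>\<^bsub>M\<^esub> c = b \<otimes>\<^bsub>M\<^esub> c"
      using that c mult closed B.r_cancel inj by (metis inj_onD)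
  qed
qed

lemma unique_roots_mon:
  assumes M: "monoid M" and B: "monoid B" and f: "f \<in> mon M B" and one: "f \<one>\<^bsub>M\<^esub> = \<one>\<^bsub>B\<^esub>"
    and roots: "unique_roots B"
  shows "unique_roots M"
proof -
  interpret M: monoid M by fact
  interpret B: monoid B by fact
  have hom: "f \<in> hom M B" and inj: "inj_on f (carrier M)" using f by (auto simp: mon_def)
  have pow: "f (a [^]\<^bsub>M\<^esub> n) = f a [^]\<^bsub>B\<^esub> n" if "a \<in> carrier M" for a and n :: nat
    using that by (induction n) (simp_all add: one hom_mult[OF hom])
  show ?thesis
    unfolding unique_roots_def
  proof (intro ballI allI impI)
    fix a b and n :: nat
    assume ab: "a \<in> carrier M" "b \<in> carrier M" and n: "n \<ge> 1" "a [^]\<^bsub>M\<^esub> n = b [^]\<^bsub>M\<^esub> n"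
    have "f a [^]\<^bsub>B\<^esub> n = f b [^]\<^bsub>B\<^esub> n" using ab n by (simp flip: pow)
    then have "f a = f b" using roots n(1) ab hom_in_carrier[OF hom] by (simp add: unique_roots_def)
    then show "a = b" using ab inj_onD[OF inj] by blast
  qed
qed

lemma group_of_quotientsI:
  assumes "monoid M" "group G" "f \<in> mon M G" "f \<one>\<^bsub>M\<^esub> = \<one>\<^bsub>G\<^esub>"
    and "\<And>g. g \<in> carrier G \<Longrightarrow>
      \<exists>a \<in> carrier M. \<exists>b \<in> carrier M. g = inv\<^bsub>G\<^esub> (f a) \<otimes>\<^bsub>G\<^esub> f b"
  shows "group_of_quotients G M"
  unfolding group_of_quotients_def
  using mon_image_submonoid[OF assms(1,3,4)] assms(2,5) by (intro conjI exI[of _ "f ` carrier M"]) auto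

lemma group_of_quotientsE:
  assumes "monoid M" "group_of_quotients G M"
  obtains f where "f \<in> mon M G" "f \<one>\<^bsub>M\<^esub> = \<one>\<^bsub>G\<^esub>"
    "\<And>g. g \<in> carrier G \<Longrightarrow>
      \<exists>a \<in> carrier M. \<exists>b \<in> carrier M. g = inv\<^bsub>G\<^esub> (f a) \<otimes>\<^bsub>G\<^esub> f b"
proof -
  have "monoid G" using assms(2) by (simp add: group_of_quotients_def group.is_monoid)
  obtain H f where H: "submonoid H G" and f: "f \<in> iso M (G\<lparr>carrier := H\<rparr>)"
    and gen: "\<forall>g \<in> carrier G. \<exists>a \<in> H. \<exists>b \<in> H. g = inv\<^bsub>G\<^esub> a \<otimes>\<^bsub>G\<^esub> b"
    using assms(2) unfolding group_of_quotients_def is_iso_def by blast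
  have "f \<in> mon M G"
    using f submonoid.subset[OF H] by (auto simp: mon_def iso_iff hom_def)
  moreover have "f \<one>\<^bsub>M\<^esub> = \<one>\<^bsub>G\<^esub>"
    using iso_monoid_one[OF assms(1) _ f] submonoid.submonoid_is_monoid[OF H \<open>monoid G\<close>] by simp
  moreover have "f ` carrier M = H" using f by (simp add: iso_iff)
  ultimately show ?thesis using that[of f] gen by blast
qed

text \<open>
  Groups of quotients can be moved along injections of their carrier into another type.
\<close>

lemma group_of_quotients_image_group:
  assumes M: "monoid M" and G: "group_of_quotients G M" and \<phi>: "inj_on \<phi> (carrier G)"
  shows "group_of_quotients (image_group \<phi> G) M"
proof -
  interpret G: group G using G by (simp add: group_of_quotients_def)
  let ?I = "image_group \<phi> G"
  have I: "group ?I" by (rule G.inj_imp_image_group_is_group[OF \<phi>])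
  interpret \<phi>: group_hom G ?I \<phi>
    using I inj_imp_image_group_iso[OF \<phi>]
    by (simp add: group_hom_def group_hom_axioms_def G.is_group iso_iff)
  obtain f where f: "f \<in> mon M G" "f \<one>\<^bsub>M\<^esub> = \<one>\<^bsub>G\<^esub>"
    and gen: "\<And>g. g \<in> carrier G \<Longrightarrow>
      \<exists>a \<in> carrier M. \<exists>b \<in> carrier M. g = inv\<^bsub>G\<^esub> (f a) \<otimes>\<^bsub>G\<^esub> f b"
    using group_of_quotientsE[OF M G] by blast
  have hom: "f \<in> hom M G" and inj: "inj_on f (carrier M)" using f by (auto simp: mon_def)
  have fc: "f ` carrier M \<subseteq> carrier G" using hom by (auto simp: hom_def)
  show ?thesis
  proof (rule group_of_quotientsI[where f = "\<phi> \<circ> f"])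
    show "\<phi> \<circ> f \<in> mon M ?I"
      using hom_compose[OF hom \<phi>.homh] comp_inj_on[OF inj inj_on_subset[OF \<phi> fc]]
      by (simp add: mon_def)
    show "(\<phi> \<circ> f) \<one>\<^bsub>M\<^esub> = \<one>\<^bsub>?I\<^esub>" by (simp add: f(2))
    show "\<exists>a \<in> carrier M. \<exists>b \<in> carrier M. g = inv\<^bsub>?I\<^esub> (\<phi> \<circ> f) a \<otimes>\<^bsub>?I\<^esub> (\<phi> \<circ> f) b"
      if g: "g \<in> carrier ?I" for g
    proof -
      obtain g' where g': "g' \<in> carrier G" "g = \<phi> g'"
        using g unfolding image_group_carrier by blast
      obtain a b where ab: "a \<in> carrier M" "b \<in> carrier M" "g' = inv\<^bsub>G\<^esub> (f a) \<otimes>\<^bsub>G\<^esub> f b"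
        using gen[OF g'(1)] by blast
      then have "g = inv\<^bsub>?I\<^esub> (\<phi> \<circ> f) a \<otimes>\<^bsub>?I\<^esub> (\<phi> \<circ> f) b"
        using g'(2) hom_in_carrier[OF hom] by simp
      then show ?thesis using ab by blast
    qed
  qed (use M I in auto)
qed

section \<open>The group of quotients of an Ore monoid\<close>

locale ore_monoid = monoid_cancel +
  assumes right_ore: "\<lbrakk>x \<in> carrier G; y \<in> carrier G\<rbrakk>
      \<Longrightarrow> \<exists>s \<in> carrier G. \<exists>t \<in> carrier G. x \<otimes> s = y \<otimes> t"
    and left_ore: "\<lbrakk>x \<in> carrier G; y \<in> carrier G\<rbrakk>
      \<Longrightarrow> \<exists>s \<in> carrier G. \<exists>t \<in> carrier G. s \<otimes> x = t \<otimes> y"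

text \<open>
  The term \<open>q(x, y, z)\<close> begins with \<open>x\<close> and \<open>q(y, x, z)\<close> with \<open>y\<close>, so their equality is a
  common right multiple of \<open>x\<close> and \<open>y\<close>. One of the two terms ends with \<open>x\<close> and the other with \<open>y\<close>
  (which one depends on the parity of the index), so it is a common left multiple as well.
\<close>

lemma nilpotent_cancel_ore:
  assumes nil: "nilpotent_monoid (Suc k) M" and "monoid_cancel M"
  shows "ore_monoid M"
proof -
  interpret monoid_cancel M by fact
  let ?q = "\<lambda>k x y. q_term M (Suc k) x y (\<lambda>_. \<one>\<^bsub>M\<^esub>)"
  have closed: "?q k x y \<in> carrier M" if "x \<in> carrier M" "y \<in> carrier M" for k x y
    using that by (intro q_term_closed) auto
  have eq: "?q k x y = ?q k y x" if "x \<in> carrier M" "y \<in> carrier M" for x y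
    using nil that by (auto simp: nilpotent_monoid_def)
  have starts: "\<exists>s \<in> carrier M. ?q j x y = x \<otimes>\<^bsub>M\<^esub> s"
    if "x \<in> carrier M" "y \<in> carrier M" for j x y
    using that
  proof (induction j)
    case (Suc j)
    then obtain s where "s \<in> carrier M" "?q j x y = x \<otimes>\<^bsub>M\<^esub> s" by blast
    then show ?case
      using Suc.prems closed[of y x j] by (intro bexI[of _ "s \<otimes>\<^bsub>M\<^esub> ?q j y x"]) (simp_all add: m_assoc)
  qed auto
  have ends: "(\<exists>s \<in> carrier M. \<exists>t \<in> carrier M. ?q j x y = s \<otimes>\<^bsub>M\<^esub> x \<and> ?q j y x = t \<otimes>\<^bsub>M\<^esub> y) \<or>
    (\<exists>s \<in> carrier M. \<exists>t \<in> carrier M. ?q j x y = s \<otimes>\<^bsub>M\<^esub> y \<and> ?q j y x = t \<otimes>\<^bsub>M\<^esub> x)"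
    if xy: "x \<in> carrier M" "y \<in> carrier M" for j x y
  proof (induction j)
    case 0
    then show ?case using xy by auto
  next
    case (Suc j)
    have step: "?q (Suc j) x' y' = (?q j x' y' \<otimes>\<^bsub>M\<^esub> s) \<otimes>\<^bsub>M\<^esub> w \<and> ?q j x' y' \<otimes>\<^bsub>M\<^esub> s \<in> carrier M"
      if "?q j y' x' = s \<otimes>\<^bsub>M\<^esub> w" "s \<in> carrier M" "w \<in> carrier M" "x' \<in> carrier M" "y' \<in> carrier M"
      for x' y' s w
      using that closed[of x' y' j] by (simp add: m_assoc)
    from Suc show ?case
    proof (elim disjE bexE conjE)
      fix s t assume "s \<in> carrier M" "t \<in> carrier M" "?q j x y = s \<otimes>\<^bsub>M\<^esub> x" "?q j y x = t \<otimes>\<^bsub>M\<^esub> y"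
      then show ?thesis using step[of y x t y] step[of x y s x] xy by blast
    next
      fix s t assume "s \<in> carrier M" "t \<in> carrier M" "?q j x y = s \<otimes>\<^bsub>M\<^esub> y" "?q j y x = t \<otimes>\<^bsub>M\<^esub> x"
      then show ?thesis using step[of y x t x] step[of x y s y] xy by blast
    qed
  qed
  show ?thesis
  proof
    fix x y assume xy: "x \<in> carrier M" "y \<in> carrier M"
    show "\<exists>s \<in> carrier M. \<exists>t \<in> carrier M. x \<otimes>\<^bsub>M\<^esub> s = y \<otimes>\<^bsub>M\<^esub> t"
      using starts[OF xy, of k] starts[OF xy(2,1), of k] eq[OF xy] by metis
    show "\<exists>s \<in> carrier M. \<exists>t \<in> carrier M. s \<otimes>\<^bsub>M\<^esub> x = t \<otimes>\<^bsub>M\<^esub> y"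
      using ends[OF xy, of k] eq[OF xy] by metis
  qed
qed

context ore_monoid
begin

text \<open>
  Left multiplication by a quotient \<open>g = a\<inverse> b\<close> is only partially defined on the monoid: it
  relates \<open>x\<close> to \<open>y\<close> when \<open>b x = a y\<close>. Such a relation is compatible with right multiplication in
  both directions (saturated), it is the graph of a partial injection, and its domain and range meet
  every principal right ideal. The relations with these properties are closed under composition
  followed by saturation, and they form the group of quotients. Compared with classes of fractions,
  nothing has to be shown independent of representatives, and associativity comes from that of
  composition.
\<close>

definition saturated :: "('a \<times> 'a) set \<Rightarrow> bool" where
  "saturated r \<longleftrightarrow> r \<subseteq> carrier G \<times> carrier G \<and>
     (\<forall>x \<in> carrier G. \<forall>y \<in> carrier G. \<forall>m \<in> carrier G. (x \<otimes> m, y \<otimes> m) \<in> r \<longleftrightarrow> (x, y) \<in> r)"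

definition cofinal_map :: "('a \<times> 'a) set \<Rightarrow> bool" where
  "cofinal_map r \<longleftrightarrow> saturated r \<and> single_valued r \<and>
     (\<forall>x \<in> carrier G. \<exists>m \<in> carrier G. x \<otimes> m \<in> Domain r)"

definition saturation :: "('a \<times> 'a) set \<Rightarrow> ('a \<times> 'a) set" where
  "saturation r = {(x, y) \<in> carrier G \<times> carrier G. \<exists>m \<in> carrier G. (x \<otimes> m, y \<otimes> m) \<in> r}"

text \<open>
  Relations compose from left to right, while multiplications by \<open>r\<close> and \<open>s\<close> compose like
  functions; hence the order of the factors in \<open>s O r\<close>.
\<close>

definition ore_group :: "('a \<times> 'a) set monoid" where
  "ore_group = \<lparr>carrier = {r. cofinal_map r \<and> cofinal_map (r\<inverse>)},
     monoid.mult = (\<lambda>r s. saturation (s O r)), one = Id_on (carrier G)\<rparr>"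

definition left_mult :: "'a \<Rightarrow> ('a \<times> 'a) set" where
  "left_mult a = {(x, a \<otimes> x) | x. x \<in> carrier G}"

lemma saturation_converse: "(saturation r)\<inverse> = saturation (r\<inverse>)"
  by (auto simp: saturation_def)

lemma saturated_iff:
  "\<lbrakk>saturated r; x \<in> carrier G; y \<in> carrier G; m \<in> carrier G\<rbrakk> \<Longrightarrow> (x \<otimes> m, y \<otimes> m) \<in> r \<longleftrightarrow> (x, y) \<in> r"
  by (simp add: saturated_def)

lemma saturatedD:
  "\<lbrakk>saturated r; (x, y) \<in> r; m \<in> carrier G\<rbrakk> \<Longrightarrow> (x \<otimes> m, y \<otimes> m) \<in> r"
  unfolding saturated_def by blast

lemma saturated_carrier: "\<lbrakk>saturated r; (x, y) \<in> r\<rbrakk> \<Longrightarrow> x \<in> carrier G \<and> y \<in> carrier G"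
  by (auto simp: saturated_def)

lemma saturation_increasing:
  "\<lbrakk>(x, y) \<in> r; x \<in> carrier G; y \<in> carrier G\<rbrakk> \<Longrightarrow> (x, y) \<in> saturation r"
  unfolding saturation_def by (auto intro!: bexI[of _ \<one>])

lemma saturation_id:
  assumes r: "saturated r"
  shows "saturation r = r"
proof
  show "saturation r \<subseteq> r" using saturated_iff[OF r] by (auto simp: saturation_def)
  show "r \<subseteq> saturation r" using saturation_increasing saturated_carrier[OF r] by auto
qed

text \<open>
  Composing and saturating each introduce their own right multipliers; the right Ore condition
  brings two of them to a common right multiple, along which compatible pairs can be transported.
\<close>

lemma cofinal_map_mult:
  assumes r: "cofinal_map r" and s: "cofinal_map s"
  shows "cofinal_map (saturation (s O r))"
proof -
  have sat: "saturated r" "saturated s" and sv: "single_valued r" "single_valued s"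
    using r s by (auto simp: cofinal_map_def)
  have comp: "(x \<otimes> m, z \<otimes> m) \<in> s O r" if "(x, z) \<in> s O r" "m \<in> carrier G" for x z m
    using that saturatedD[OF sat(1)] saturatedD[OF sat(2)] by blast
  have comp_closed: "x \<in> carrier G \<and> z \<in> carrier G" if "(x, z) \<in> s O r" for x z
    using that saturated_carrier sat by blast
  have "saturated (saturation (s O r))"
    unfolding saturated_def
  proof (intro conjI ballI iffI)
    show "saturation (s O r) \<subseteq> carrier G \<times> carrier G" by (auto simp: saturation_def)
    fix x y m assume c: "x \<in> carrier G" "y \<in> carrier G" "m \<in> carrier G"
    show "(x, y) \<in> saturation (s O r)" if xy: "(x \<otimes> m, y \<otimes> m) \<in> saturation (s O r)"
    proof -
      obtain k where "k \<in> carrier G" "(x \<otimes> m \<otimes> k, y \<otimes> m \<otimes> k) \<in> s O r"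
        using xy unfolding saturation_def by blast
      then show ?thesis
        using c unfolding saturation_def by (auto simp: m_assoc intro!: bexI[of _ "m \<otimes> k"])
    qed
    show "(x \<otimes> m, y \<otimes> m) \<in> saturation (s O r)" if xy: "(x, y) \<in> saturation (s O r)"
    proof -
      obtain k where k: "k \<in> carrier G" "(x \<otimes> k, y \<otimes> k) \<in> s O r"
        using xy unfolding saturation_def by blast
      obtain p q where pq: "p \<in> carrier G" "q \<in> carrier G" "m \<otimes> p = k \<otimes> q"
        using right_ore[OF c(3) k(1)] by blast
      have "(x \<otimes> k \<otimes> q, y \<otimes> k \<otimes> q) \<in> s O r" using comp[OF k(2) pq(2)] .
      then have "(x \<otimes> m \<otimes> p, y \<otimes> m \<otimes> p) \<in> s O r" using c k(1) pq by (simp add: m_assoc)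
      then show ?thesis using c pq unfolding saturation_def by blast
    qed
  qed
  moreover have "single_valued (saturation (s O r))"
  proof (rule single_valuedI)
    fix x z z' assume "(x, z) \<in> saturation (s O r)" "(x, z') \<in> saturation (s O r)"
    then obtain m m' where c: "x \<in> carrier G" "z \<in> carrier G" "z' \<in> carrier G" "m \<in> carrier G" "m' \<in> carrier G"
      and mm: "(x \<otimes> m, z \<otimes> m) \<in> s O r" "(x \<otimes> m', z' \<otimes> m') \<in> s O r"
      unfolding saturation_def by blast
    obtain p q where pq: "p \<in> carrier G" "q \<in> carrier G" "m \<otimes> p = m' \<otimes> q"
      using right_ore[OF c(4,5)] by blast
    have "(x \<otimes> m \<otimes> p, z \<otimes> m \<otimes> p) \<in> s O r" "(x \<otimes> m' \<otimes> q, z' \<otimes> m' \<otimes> q) \<in> s O r"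
      using comp mm pq by blast+
    moreover have "x \<otimes> m' \<otimes> q = x \<otimes> m \<otimes> p" "z' \<otimes> m' \<otimes> q = z' \<otimes> (m \<otimes> p)"
      using c pq by (simp_all add: m_assoc)
    ultimately have "z \<otimes> m \<otimes> p = z' \<otimes> (m \<otimes> p)"
      using single_valued_relcomp[OF sv(2,1)] by (metis single_valuedD)
    then show "z = z'" using c pq r_cancel[of z "m \<otimes> p" z'] by (simp add: m_assoc)
  qed
  moreover have "\<exists>m \<in> carrier G. x \<otimes> m \<in> Domain (saturation (s O r))" if x: "x \<in> carrier G" for x
  proof -
    obtain m y where m: "m \<in> carrier G" "(x \<otimes> m, y) \<in> s"
      using s x unfolding cofinal_map_def by blast
    have y: "y \<in> carrier G" using saturated_carrier[OF sat(2) m(2)] by simp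
    obtain k z where k: "k \<in> carrier G" "(y \<otimes> k, z) \<in> r"
      using r y unfolding cofinal_map_def by blast
    have "(x \<otimes> m \<otimes> k, y \<otimes> k) \<in> s" by (rule saturatedD[OF sat(2) m(2) k(1)])
    then have *: "(x \<otimes> (m \<otimes> k), z) \<in> s O r" using k x m by (auto simp: m_assoc)
    then have "(x \<otimes> (m \<otimes> k), z) \<in> saturation (s O r)"
      using comp_closed[OF *] by (intro saturation_increasing) auto
    then show ?thesis using m k by blast
  qed
  ultimately show ?thesis by (simp add: cofinal_map_def)
qed

text \<open>
  Both sides are the saturation of the threefold composition: a multiplier used in an inner
  saturation can be absorbed into the outer one, because the third relation is compatible with right
  multiplication.
\<close>

lemma saturation_assoc:
  assumes "saturated r" "saturated s" "saturated t"
  shows "saturation (t O saturation (s O r)) = saturation (saturation (t O s) O r)"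
proof -
  have "saturation (t O saturation (s O r)) = saturation (t O s O r)"
  proof safe
    fix x z assume "(x, z) \<in> saturation (t O saturation (s O r))"
    then obtain m y where m: "x \<in> carrier G" "z \<in> carrier G" "m \<in> carrier G" "(x \<otimes> m, y) \<in> t"
      "(y, z \<otimes> m) \<in> saturation (s O r)"
      unfolding saturation_def by auto
    then obtain k where k: "y \<in> carrier G" "k \<in> carrier G" "(y \<otimes> k, z \<otimes> m \<otimes> k) \<in> s O r"
      unfolding saturation_def by auto
    have "(x \<otimes> m \<otimes> k, y \<otimes> k) \<in> t" by (rule saturatedD[OF assms(3) m(4) k(2)])
    then have "(x \<otimes> (m \<otimes> k), z \<otimes> (m \<otimes> k)) \<in> t O s O r"
      using k(3) m k by (auto simp: m_assoc)
    then show "(x, z) \<in> saturation (t O s O r)" using m k unfolding saturation_def by blast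
  next
    fix x z assume "(x, z) \<in> saturation (t O s O r)"
    then obtain m y where m: "x \<in> carrier G" "z \<in> carrier G" "m \<in> carrier G" "(x \<otimes> m, y) \<in> t"
      "(y, z \<otimes> m) \<in> s O r"
      unfolding saturation_def by auto
    have y: "y \<in> carrier G" using saturated_carrier[OF assms(3) m(4)] by simp
    have "(y, z \<otimes> m) \<in> saturation (s O r)"
      using m y by (intro saturation_increasing) auto
    then show "(x, z) \<in> saturation (t O saturation (s O r))" using m unfolding saturation_def by blast
  qed
  moreover have "saturation (saturation (t O s) O r) = saturation ((t O s) O r)"
  proof safe
    fix x z assume "(x, z) \<in> saturation (saturation (t O s) O r)"
    then obtain m y where m: "x \<in> carrier G" "z \<in> carrier G" "m \<in> carrier G" "(y, z \<otimes> m) \<in> r"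
      "(x \<otimes> m, y) \<in> saturation (t O s)"
      unfolding saturation_def by auto
    then obtain k where k: "y \<in> carrier G" "k \<in> carrier G" "(x \<otimes> m \<otimes> k, y \<otimes> k) \<in> t O s"
      unfolding saturation_def by auto
    have "(y \<otimes> k, z \<otimes> m \<otimes> k) \<in> r" by (rule saturatedD[OF assms(1) m(4) k(2)])
    then have "(x \<otimes> (m \<otimes> k), z \<otimes> (m \<otimes> k)) \<in> (t O s) O r"
      using k(3) m k by (auto simp: m_assoc)
    then show "(x, z) \<in> saturation ((t O s) O r)" using m k unfolding saturation_def by blast
  next
    fix x z assume "(x, z) \<in> saturation ((t O s) O r)"
    then obtain m y where m: "x \<in> carrier G" "z \<in> carrier G" "m \<in> carrier G" "(x \<otimes> m, y) \<in> t O s"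
      "(y, z \<otimes> m) \<in> r"
      unfolding saturation_def by auto
    have y: "y \<in> carrier G" using saturated_carrier[OF assms(1) m(5)] by simp
    have "(x \<otimes> m, y) \<in> saturation (t O s)"
      using m y by (intro saturation_increasing) auto
    then show "(x, z) \<in> saturation (saturation (t O s) O r)" using m unfolding saturation_def by blast
  qed
  ultimately show ?thesis by (simp add: O_assoc)
qed

lemma saturation_inverse:
  assumes r: "cofinal_map r" "cofinal_map (r\<inverse>)"
  shows "saturation (r O r\<inverse>) = Id_on (carrier G)"
proof safe
  fix x z assume "(x, z) \<in> saturation (r O r\<inverse>)"
  then obtain m y where m: "x \<in> carrier G" "z \<in> carrier G" "m \<in> carrier G" "(x \<otimes> m, y) \<in> r" "(z \<otimes> m, y) \<in> r"
    unfolding saturation_def by auto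
  then have "x \<otimes> m = z \<otimes> m"
    using r(2) unfolding cofinal_map_def by (meson converse_iff single_valuedD)
  then show "(x, z) \<in> Id_on (carrier G)" using m r_cancel by blast
next
  fix x assume "x \<in> carrier G"
  then show "(x, x) \<in> saturation (r O r\<inverse>)"
    using r(1) unfolding cofinal_map_def saturation_def by blast
qed

lemma cofinal_map_one: "cofinal_map (Id_on (carrier G))"
proof -
  have "saturated (Id_on (carrier G))"
    unfolding saturated_def
  proof (intro conjI ballI)
    fix x y m assume "x \<in> carrier G" "y \<in> carrier G" "m \<in> carrier G"
    then show "(x \<otimes> m, y \<otimes> m) \<in> Id_on (carrier G) \<longleftrightarrow> (x, y) \<in> Id_on (carrier G)"
      using r_cancel[of x m y] by (auto simp: Id_on_iff)
  qed auto
  moreover have "\<exists>m \<in> carrier G. x \<otimes> m \<in> Domain (Id_on (carrier G))" if "x \<in> carrier G" for x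
    using that by (intro bexI[of _ \<one>]) auto
  ultimately show ?thesis unfolding cofinal_map_def by (simp only: single_valued_Id_on) blast
qed

lemma ore_group_group: "group ore_group"
proof (rule groupI)
  fix r assume r: "r \<in> carrier ore_group"
  then have "r\<inverse> \<in> carrier ore_group" by (simp add: ore_group_def)
  moreover have "r\<inverse> \<otimes>\<^bsub>ore_group\<^esub> r = \<one>\<^bsub>ore_group\<^esub>"
    using r saturation_inverse by (simp add: ore_group_def)
  ultimately show "\<exists>s \<in> carrier ore_group. s \<otimes>\<^bsub>ore_group\<^esub> r = \<one>\<^bsub>ore_group\<^esub>" by blast
  have "r O Id_on (carrier G) = r"
    using r by (auto simp: ore_group_def cofinal_map_def dest: saturated_carrier)
  then show "\<one>\<^bsub>ore_group\<^esub> \<otimes>\<^bsub>ore_group\<^esub> r = r"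
    using r saturation_id by (simp add: ore_group_def cofinal_map_def)
next
  fix r s assume "r \<in> carrier ore_group" "s \<in> carrier ore_group"
  then show "r \<otimes>\<^bsub>ore_group\<^esub> s \<in> carrier ore_group"
    by (simp add: ore_group_def saturation_converse converse_relcomp cofinal_map_mult)
next
  fix r s t assume "r \<in> carrier ore_group" "s \<in> carrier ore_group" "t \<in> carrier ore_group"
  then show "r \<otimes>\<^bsub>ore_group\<^esub> s \<otimes>\<^bsub>ore_group\<^esub> t = r \<otimes>\<^bsub>ore_group\<^esub> (s \<otimes>\<^bsub>ore_group\<^esub> t)"
    by (simp add: ore_group_def cofinal_map_def saturation_assoc)
qed (simp add: ore_group_def cofinal_map_one)

lemma left_mult_carrier:
  assumes a: "a \<in> carrier G"
  shows "left_mult a \<in> carrier ore_group"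
proof -
  have "(x \<otimes> m, y \<otimes> m) \<in> left_mult a \<longleftrightarrow> (x, y) \<in> left_mult a"
    if "x \<in> carrier G" "y \<in> carrier G" "m \<in> carrier G" for x y m
    using that a r_cancel[of y m "a \<otimes> x"] by (auto simp: left_mult_def m_assoc)
  then have "saturated (left_mult a)" "saturated ((left_mult a)\<inverse>)"
    using a by (auto simp: saturated_def left_mult_def)
  moreover have "single_valued (left_mult a)" "single_valued ((left_mult a)\<inverse>)"
    using a l_cancel by (auto simp: single_valued_def left_mult_def)
  moreover have "\<exists>m \<in> carrier G. x \<otimes> m \<in> Domain (left_mult a)" if "x \<in> carrier G" for x
    using that by (auto simp: left_mult_def)
  moreover have "\<exists>m \<in> carrier G. x \<otimes> m \<in> Domain ((left_mult a)\<inverse>)" if x: "x \<in> carrier G" for x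
  proof -
    obtain s t where "s \<in> carrier G" "t \<in> carrier G" "x \<otimes> s = a \<otimes> t" using right_ore[OF x a] by blast
    then show ?thesis by (auto simp: left_mult_def)
  qed
  ultimately show ?thesis by (simp add: ore_group_def cofinal_map_def)
qed

lemma left_mult_mon: "left_mult \<in> mon G ore_group"
proof -
  have "left_mult (a \<otimes> b) = saturation (left_mult b O left_mult a)"
    if "a \<in> carrier G" "b \<in> carrier G" for a b
  proof -
    have "left_mult b O left_mult a = left_mult (a \<otimes> b)"
      using that by (fastforce simp: left_mult_def m_assoc)
    then show ?thesis
      using saturation_id left_mult_carrier[of "a \<otimes> b"] that
      by (simp add: ore_group_def cofinal_map_def)
  qed
  then have "left_mult \<in> hom G ore_group"
    using left_mult_carrier by (auto simp: hom_def ore_group_def)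
  moreover have "inj_on left_mult (carrier G)"
  proof (rule inj_onI)
    fix a b assume ab: "a \<in> carrier G" "b \<in> carrier G" "left_mult a = left_mult b"
    have "(\<one>, a \<otimes> \<one>) \<in> left_mult b" unfolding ab(3)[symmetric] by (auto simp: left_mult_def)
    then have "a \<otimes> \<one> = b \<otimes> \<one>" unfolding left_mult_def by blast
    then show "a = b" using ab by simp
  qed
  ultimately show ?thesis by (simp add: mon_def)
qed

text \<open>
  An element of the group is determined by any pair \<open>(x, y)\<close> in it, as the right fraction
  \<open>y x\<inverse>\<close>.
\<close>

lemma ore_group_eqI:
  assumes r: "r \<in> carrier ore_group" and s: "s \<in> carrier ore_group"
    and xy: "(x, y) \<in> r" "(x, y) \<in> s"
  shows "r = s"
proof -
  have "r \<subseteq> s" if r: "cofinal_map r" and s: "cofinal_map s" and xy: "(x, y) \<in> r" "(x, y) \<in> s" for r s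
  proof safe
    have sat: "saturated r" "saturated s" and sv: "single_valued r"
      using r s by (auto simp: cofinal_map_def)
    fix u v assume uv: "(u, v) \<in> r"
    have c: "x \<in> carrier G" "y \<in> carrier G" "u \<in> carrier G" "v \<in> carrier G"
      using saturated_carrier[OF sat(1)] xy uv by auto
    obtain p q where pq: "p \<in> carrier G" "q \<in> carrier G" "x \<otimes> p = u \<otimes> q" using right_ore[OF c(1,3)] by blast
    have "(x \<otimes> p, y \<otimes> p) \<in> r" "(u \<otimes> q, v \<otimes> q) \<in> r"
      using saturatedD[OF sat(1)] xy uv pq(1,2) by blast+
    then have "y \<otimes> p = v \<otimes> q" using single_valuedD[OF sv] pq by metis
    moreover have "(x \<otimes> p, y \<otimes> p) \<in> s" using saturatedD[OF sat(2)] xy pq(1) by blast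
    ultimately have "(u \<otimes> q, v \<otimes> q) \<in> s" using pq by simp
    then show "(u, v) \<in> s" using saturated_iff[OF sat(2)] c pq by blast
  qed
  then show ?thesis using assms by (simp add: ore_group_def subset_antisym)
qed

lemma ore_group_nonempty:
  assumes r: "r \<in> carrier ore_group"
  obtains x y where "x \<in> carrier G" "y \<in> carrier G" "(x, y) \<in> r"
proof -
  obtain m where m: "\<one> \<otimes> m \<in> Domain r"
    using r one_closed unfolding ore_group_def cofinal_map_def by simp blast
  then obtain y where "(\<one> \<otimes> m, y) \<in> r" by blast
  moreover have "saturated r" using r by (simp add: ore_group_def cofinal_map_def)
  ultimately show ?thesis using that saturated_carrier by blast
qed

lemma ore_group_lepoll: "carrier ore_group \<lesssim> carrier G \<times> carrier G"
proof -
  have "\<exists>p. p \<in> carrier G \<times> carrier G \<and> p \<in> r" if r: "r \<in> carrier ore_group" for r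
  proof -
    obtain x y where "x \<in> carrier G" "y \<in> carrier G" "(x, y) \<in> r" using ore_group_nonempty[OF r] .
    then show ?thesis by (intro exI[of _ "(x, y)"]) simp
  qed
  then obtain p where p: "\<And>r. r \<in> carrier ore_group \<Longrightarrow> p r \<in> carrier G \<times> carrier G \<and> p r \<in> r"
    by metis
  have "inj_on p (carrier ore_group)"
  proof (rule inj_onI)
    fix r s assume rs: "r \<in> carrier ore_group" "s \<in> carrier ore_group" "p r = p s"
    obtain x y where "p r = (x, y)" by fastforce
    then show "r = s" using p[OF rs(1)] p[OF rs(2)] rs(3) ore_group_eqI[OF rs(1,2), of x y] by simp
  qed
  then show ?thesis using p by (auto simp: lepoll_def)
qed

text \<open>
  An element containing the pair \<open>(x, y)\<close> is the right fraction \<open>y x\<inverse>\<close>. A common left multiple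
  \<open>s y = t x\<close> turns it into the left fraction \<open>s\<inverse> t\<close>.
\<close>

lemma ore_group_of_quotients: "group_of_quotients ore_group G"
proof (rule group_of_quotientsI[where f = left_mult])
  interpret O: group ore_group by (rule ore_group_group)
  show "left_mult \<one> = \<one>\<^bsub>ore_group\<^esub>"
    by (auto simp: left_mult_def ore_group_def)
  fix r assume r: "r \<in> carrier ore_group"
  obtain x y where xy: "x \<in> carrier G" "y \<in> carrier G" "(x, y) \<in> r" using ore_group_nonempty[OF r] .
  obtain s t where st: "s \<in> carrier G" "t \<in> carrier G" "s \<otimes> y = t \<otimes> x" using left_ore[OF xy(2,1)] by blast
  note lm = left_mult_carrier[OF st(1)] left_mult_carrier[OF st(2)]
  have "left_mult s \<otimes>\<^bsub>ore_group\<^esub> r = left_mult t"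
  proof (rule ore_group_eqI)
    have "(x, s \<otimes> y) \<in> r O left_mult s" using xy by (auto simp: left_mult_def)
    then show "(x, s \<otimes> y) \<in> left_mult s \<otimes>\<^bsub>ore_group\<^esub> r"
      using xy st by (simp add: ore_group_def saturation_increasing)
    show "(x, s \<otimes> y) \<in> left_mult t" using xy st by (auto simp: left_mult_def)
  qed (use r lm in auto)
  then have "r = inv\<^bsub>ore_group\<^esub> (left_mult s) \<otimes>\<^bsub>ore_group\<^esub> left_mult t"
    using r lm O.inv_solve_left by blast
  then show "\<exists>a \<in> carrier G. \<exists>b \<in> carrier G.
      r = inv\<^bsub>ore_group\<^esub> (left_mult a) \<otimes>\<^bsub>ore_group\<^esub> left_mult b"
    using st by blast
qed (simp_all add: left_mult_mon ore_group_group monoid_axioms)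

end

section \<open>Unique roots and size of the group of quotients\<close>

text \<open>
  Uniqueness of roots restricted to commuting elements is easy to verify in residuated lattices and
  already controls torsion in the centre of a group of quotients.
\<close>

definition commuting_roots_unique :: "('a, 'm) monoid_scheme \<Rightarrow> bool" where
  "commuting_roots_unique M \<longleftrightarrow> (\<forall>a \<in> carrier M. \<forall>b \<in> carrier M. \<forall>n::nat.
     n \<ge> 1 \<longrightarrow> a \<otimes>\<^bsub>M\<^esub> b = b \<otimes>\<^bsub>M\<^esub> a \<longrightarrow> a [^]\<^bsub>M\<^esub> n = b [^]\<^bsub>M\<^esub> n \<longrightarrow> a = b)"

lemma iso_inv_into:
  assumes "monoid M" "f \<in> iso M N"
  shows "inv_into (carrier M) f \<in> iso N M"
proof -
  have hom: "f \<in> hom M N" and bij: "bij_betw f (carrier M) (carrier N)"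
    using assms(2) by (auto simp: iso_def)
  let ?g = "inv_into (carrier M) f"
  have g: "?g y \<in> carrier M" "f (?g y) = y" if "y \<in> carrier N" for y
    using that bij by (auto simp: bij_betw_def inv_into_into f_inv_into_f)
  have "?g (y \<otimes>\<^bsub>N\<^esub> z) = ?g y \<otimes>\<^bsub>M\<^esub> ?g z" if "y \<in> carrier N" "z \<in> carrier N" for y z
    using that g bij assms(1)
    by (intro inv_into_f_eq) (auto simp: bij_betw_def hom_mult[OF hom] monoid.m_closed)
  then show ?thesis
    using g bij_betw_inv_into[OF bij] by (auto simp: iso_def hom_def)
qed

lemma group_of_quotients_nilpotent_unique_roots:
  assumes M: "monoid M" and G: "group_of_quotients G M"
    and nil: "nilpotent_monoid (Suc k) M" and roots: "commuting_roots_unique M"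
  shows "nilpotent_group (Suc k) G" "unique_roots G"
proof -
  interpret M: monoid M by fact
  interpret G: group G using G by (simp add: group_of_quotients_def)
  obtain f where f: "f \<in> mon M G" "f \<one>\<^bsub>M\<^esub> = \<one>\<^bsub>G\<^esub>"
    and gen: "\<And>g. g \<in> carrier G \<Longrightarrow>
      \<exists>a \<in> carrier M. \<exists>b \<in> carrier M. g = inv\<^bsub>G\<^esub> (f a) \<otimes>\<^bsub>G\<^esub> f b"
    using group_of_quotientsE[OF M G] by blast
  have hom: "f \<in> hom M G" and inj: "inj_on f (carrier M)" using f by (auto simp: mon_def)
  let ?H = "f ` carrier M"
  have H: "submonoid ?H G" by (rule mon_image_submonoid[OF M f])
  have gen_H: "\<exists>a \<in> ?H. \<exists>b \<in> ?H. g = inv\<^bsub>G\<^esub> a \<otimes>\<^bsub>G\<^esub> b" if "g \<in> carrier G" for g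
    using gen[OF that] by blast
  have "f \<in> iso M (G\<lparr>carrier := ?H\<rparr>)"
    using hom inj by (auto simp: iso_iff hom_def)
  from iso_inv_into[OF M this] have "nilpotent_monoid (Suc k) (G\<lparr>carrier := ?H\<rparr>)"
    using nilpotent_monoid_mon[OF submonoid.submonoid_is_monoid[OF H G.is_monoid] _ nil]
    unfolding iso_iff_mon_epi by blast
  then show nilG: "nilpotent_group (Suc k) G"
    using G.nilpotent_of_generating_submonoid[OF H] gen_H by blast
  have pow: "f (a [^]\<^bsub>M\<^esub> n) = f a [^]\<^bsub>G\<^esub> n" if "a \<in> carrier M" for a and n :: nat
    using that by (induction n) (simp_all add: f(2) hom_mult[OF hom])
  have "a = b" if a: "a \<in> ?H" and b: "b \<in> ?H" and comm: "a \<otimes>\<^bsub>G\<^esub> b = b \<otimes>\<^bsub>G\<^esub> a"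
    and n: "n \<ge> 1" "a [^]\<^bsub>G\<^esub> n = b [^]\<^bsub>G\<^esub> n" for a b and n :: nat
  proof -
    obtain a' b' where ab: "a' \<in> carrier M" "b' \<in> carrier M" "a = f a'" "b = f b'"
      using a b by blast
    have "f (a' \<otimes>\<^bsub>M\<^esub> b') = f (b' \<otimes>\<^bsub>M\<^esub> a')" using comm ab by (simp add: hom_mult[OF hom])
    then have "a' \<otimes>\<^bsub>M\<^esub> b' = b' \<otimes>\<^bsub>M\<^esub> a'" using ab inj_onD[OF inj] by simp
    moreover have "f (a' [^]\<^bsub>M\<^esub> n) = f (b' [^]\<^bsub>M\<^esub> n)" using n ab by (simp add: pow)
    then have "a' [^]\<^bsub>M\<^esub> n = b' [^]\<^bsub>M\<^esub> n" using ab inj_onD[OF inj] by simp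
    ultimately show "a = b" using roots n(1) ab unfolding commuting_roots_unique_def by metis
  qed
  then have "\<forall>x \<in> upper_central G 1. \<forall>n \<ge> (1::nat). x [^]\<^bsub>G\<^esub> n = \<one>\<^bsub>G\<^esub> \<longrightarrow> x = \<one>\<^bsub>G\<^esub>"
    using G.centre_torsion_free_of_commuting_roots[OF H gen_H] by blast
  then show "unique_roots G" using G.nilpotent_unique_roots nilG by blast
qed

text \<open>
  Powers of an element of a finite monoid repeat, so by cancellation some positive power is the unit,
  of which the unit is a root as well.
\<close>

lemma finite_unique_roots_trivial:
  assumes "monoid_cancel M" "unique_roots M" "finite (carrier M)"
  shows "carrier M = {\<one>\<^bsub>M\<^esub>}"
proof -
  interpret monoid_cancel M by fact
  have "a = \<one>\<^bsub>M\<^esub>" if a: "a \<in> carrier M" for a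
  proof -
    have "range (\<lambda>n::nat. a [^]\<^bsub>M\<^esub> n) \<subseteq> carrier M" using a by auto
    then have "\<not> inj (\<lambda>n::nat. a [^]\<^bsub>M\<^esub> n)"
      using assms(3) finite_subset range_inj_infinite by blast
    then obtain i j :: nat where ij: "i < j" "a [^]\<^bsub>M\<^esub> i = a [^]\<^bsub>M\<^esub> j"
      by (metis injI linorder_neqE_nat)
    have "a [^]\<^bsub>M\<^esub> j = a [^]\<^bsub>M\<^esub> i \<otimes>\<^bsub>M\<^esub> a [^]\<^bsub>M\<^esub> (j - i)"
      using nat_pow_mult[OF a, of i "j - i"] ij(1) by simp
    then have "a [^]\<^bsub>M\<^esub> i \<otimes>\<^bsub>M\<^esub> \<one>\<^bsub>M\<^esub> = a [^]\<^bsub>M\<^esub> i \<otimes>\<^bsub>M\<^esub> a [^]\<^bsub>M\<^esub> (j - i)"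
      using ij(2) a by simp
    then have "a [^]\<^bsub>M\<^esub> (j - i) = \<one>\<^bsub>M\<^esub>" using a by (metis l_cancel nat_pow_closed one_closed)
    then have "a [^]\<^bsub>M\<^esub> (j - i) = \<one>\<^bsub>M\<^esub> [^]\<^bsub>M\<^esub> (j - i)" by simp
    moreover have "j - i \<ge> 1" using ij by simp
    ultimately show ?thesis using assms(2) a unfolding unique_roots_def by blast
  qed
  then show ?thesis by auto
qed

text \<open>
  This bounds the group of quotients by the monoid, and so makes it available on every type into
  which the monoid embeds. For finite monoids the bound holds because only the trivial one has
  cancellation and unique roots.
\<close>

lemma unique_roots_square_lepoll:
  assumes "monoid_cancel M" "unique_roots M"
  shows "carrier M \<times> carrier M \<lesssim> carrier M"
proof (cases "finite (carrier M)")
  case True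
  then have "carrier M = {\<one>\<^bsub>M\<^esub>}" using finite_unique_roots_trivial assms by blast
  then show ?thesis using times_singleton_eqpoll by (metis eqpoll_imp_lepoll)
next
  case False
  then show ?thesis
    using card_of_Times_same_infinite ordIso_iff_ordLeq card_of_ordLeq unfolding lepoll_def by blast
qed

section \<open>Residuated lattices and lattice-ordered groups\<close>

text \<open>
  Let \<open>J\<close> be the join of the products \<open>a\<^sup>n\<^sup>-\<^sup>1\<^sup>-\<^sup>i b\<^sup>i\<close> for \<open>i < n\<close>. By residuation, multiplication
  preserves joins, so \<open>a J\<close> and \<open>b J\<close> are the joins of the products \<open>a\<^sup>n\<^sup>-\<^sup>i b\<^sup>i\<close> over \<open>i < n\<close> and over
  \<open>0 < i \<le> n\<close>. As \<open>a\<^sup>n = b\<^sup>n\<close>, these are joins of the same set; hence \<open>a J = b J\<close>, and \<open>a = b\<close> by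
  cancellation.
\<close>

lemma (in residuated_lattice) commuting_roots_unique:
  assumes cancel: "monoid_cancel G"
  shows "commuting_roots_unique G"
  unfolding commuting_roots_unique_def
proof (intro ballI allI impI)
  interpret C: monoid_cancel G by fact
  fix a b and n :: nat
  assume a: "a \<in> carrier G" and b: "b \<in> carrier G" and n: "n \<ge> 1"
    and comm: "a \<otimes> b = b \<otimes> a" and eq: "a [^] n = b [^] n"
  define e where "e i = a [^] (n - Suc i) \<otimes> b [^] i" for i
  define A where "A = e ` {..<n}"
  have e: "e i \<in> carrier G" for i using a b by (simp add: e_def)
  have A: "finite A" "A \<subseteq> carrier L" "A \<noteq> {}" using e n by (auto simp: A_def carrier_eq lessThan_empty_iff)
  have sup: "least L (\<Squnion>\<^bsub>L\<^esub>A) (Upper L A)" by (rule finite_sup_least[OF A])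
  have J: "\<Squnion>\<^bsub>L\<^esub>A \<in> carrier G" using finite_sup_closed[OF A] carrier_eq by simp
  have J_le: "\<Squnion>\<^bsub>L\<^esub>A \<sqsubseteq>\<^bsub>L\<^esub> d \<longleftrightarrow> (\<forall>x \<in> A. x \<sqsubseteq>\<^bsub>L\<^esub> d)" if "d \<in> carrier G" for d
  proof
    assume "\<Squnion>\<^bsub>L\<^esub>A \<sqsubseteq>\<^bsub>L\<^esub> d"
    then show "\<forall>x \<in> A. x \<sqsubseteq>\<^bsub>L\<^esub> d"
      using least_Upper_above[OF sup _ A(2)] that J A(2) le_trans unfolding carrier_eq by blast
  next
    assume "\<forall>x \<in> A. x \<sqsubseteq>\<^bsub>L\<^esub> d"
    then show "\<Squnion>\<^bsub>L\<^esub>A \<sqsubseteq>\<^bsub>L\<^esub> d"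
      using least_le[OF sup] Upper_memI[of A L d] that carrier_eq by auto
  qed
  have mult_J_le: "c \<otimes> \<Squnion>\<^bsub>L\<^esub>A \<sqsubseteq>\<^bsub>L\<^esub> d \<longleftrightarrow> (\<forall>y \<in> (\<otimes>) c ` A. y \<sqsubseteq>\<^bsub>L\<^esub> d)"
    if "c \<in> carrier G" "d \<in> carrier G" for c d
  proof -
    have "A \<subseteq> carrier G" using A(2) carrier_eq by simp
    then show ?thesis
      using that J J_le[OF ldiv_closed[OF that]] residuation_left by (auto simp: subset_iff)
  qed
  \<comment> \<open>Multiplying \<open>e i\<close> by \<open>b\<close> gives \<open>a \<otimes> e (i + 1)\<close>, cyclically in \<open>i\<close>.\<close>
  have same: "(\<otimes>) a ` A = (\<otimes>) b ` A"
  proof -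
    have pow_comm: "b \<otimes> a [^] i = a [^] i \<otimes> b" for i :: nat
      using a b comm by (induction i) (simp_all add: m_assoc flip: m_assoc[of b])
    have a_e: "a \<otimes> e i = a [^] (n - i) \<otimes> b [^] i" if "i < n" for i
    proof -
      have "a \<otimes> e i = (a \<otimes> a [^] (n - Suc i)) \<otimes> b [^] i"
        using a b by (simp add: e_def m_assoc)
      also have "a \<otimes> a [^] (n - Suc i) = a [^] Suc (n - Suc i)"
        by (rule nat_pow_Suc2[OF a, symmetric])
      also have "Suc (n - Suc i) = n - i" using that by simp
      finally show ?thesis .
    qed
    have b_e: "b \<otimes> e i = a [^] (n - Suc i) \<otimes> b [^] Suc i" for i
    proof -
      have "b \<otimes> e i = a [^] (n - Suc i) \<otimes> (b \<otimes> b [^] i)"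
        using a b pow_comm[of "n - Suc i"] by (simp add: e_def m_assoc flip: m_assoc[of b])
      then show ?thesis using a b by (simp only: nat_pow_Suc2)
    qed
    show ?thesis
    proof
      show "(\<otimes>) a ` A \<subseteq> (\<otimes>) b ` A"
      proof
        fix y assume "y \<in> (\<otimes>) a ` A"
        then obtain i where i: "i < n" "y = a \<otimes> e i" by (auto simp: A_def)
        show "y \<in> (\<otimes>) b ` A"
        proof (cases i)
          case 0
          then have "y = b \<otimes> e (n - 1)" using i a_e[of 0] b_e[of "n - 1"] eq a b by simp
          then show ?thesis using i by (auto simp: A_def)
        next
          case (Suc j)
          then have "y = b \<otimes> e j" using i a_e[of i] b_e[of j] by simp
          then show ?thesis using i Suc by (auto simp: A_def)
        qed
      qed
      show "(\<otimes>) b ` A \<subseteq> (\<otimes>) a ` A"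
      proof
        fix y assume "y \<in> (\<otimes>) b ` A"
        then obtain i where i: "i < n" "y = b \<otimes> e i" by (auto simp: A_def)
        show "y \<in> (\<otimes>) a ` A"
        proof (cases "Suc i = n")
          case True
          then have "y = a \<otimes> e 0" using i a_e[of 0] b_e[of i] eq a b by (auto simp: eq)
          then show ?thesis using i by (auto simp: A_def)
        next
          case False
          then have "y = a \<otimes> e (Suc i)" "Suc i < n" using i a_e[of "Suc i"] b_e[of i] by simp_all
          then show ?thesis by (auto simp: A_def)
        qed
      qed
    qed
  qed
  have "a \<otimes> \<Squnion>\<^bsub>L\<^esub>A = b \<otimes> \<Squnion>\<^bsub>L\<^esub>A"
  proof (rule le_antisym)
    show c: "a \<otimes> \<Squnion>\<^bsub>L\<^esub>A \<in> carrier L" "b \<otimes> \<Squnion>\<^bsub>L\<^esub>A \<in> carrier L"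
      using a b J carrier_eq by auto
    show "a \<otimes> \<Squnion>\<^bsub>L\<^esub>A \<sqsubseteq>\<^bsub>L\<^esub> b \<otimes> \<Squnion>\<^bsub>L\<^esub>A" "b \<otimes> \<Squnion>\<^bsub>L\<^esub>A \<sqsubseteq>\<^bsub>L\<^esub> a \<otimes> \<Squnion>\<^bsub>L\<^esub>A"
      using c a b mult_J_le same le_refl unfolding carrier_eq by metis+
  qed
  then show "a = b" using a b J C.r_cancel by blast
qed

lemma (in lattice_ordered_group) residuated_lattice_inv:
  "residuated_lattice G L (\<lambda>a d. inv a \<otimes> d) (\<lambda>d b. d \<otimes> inv b)"
proof -
  have left: "a \<otimes> x \<sqsubseteq>\<^bsub>L\<^esub> a \<otimes> y" if "a \<in> carrier G" "x \<in> carrier G" "y \<in> carrier G" "x \<sqsubseteq>\<^bsub>L\<^esub> y" for a x y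
    using that mult_join[of a x y] le_iff_meet carrier_eq by simp
  have right: "x \<otimes> a \<sqsubseteq>\<^bsub>L\<^esub> y \<otimes> a" if "a \<in> carrier G" "x \<in> carrier G" "y \<in> carrier G" "x \<sqsubseteq>\<^bsub>L\<^esub> y" for a x y
    using that join_mult[of a x y] le_iff_meet carrier_eq by simp
  show ?thesis
  proof unfold_locales
    fix a b d assume c: "a \<in> carrier G" "b \<in> carrier G" "d \<in> carrier G"
    show "a \<otimes> b \<sqsubseteq>\<^bsub>L\<^esub> d \<longleftrightarrow> a \<sqsubseteq>\<^bsub>L\<^esub> d \<otimes> inv b"
      using right[of "inv b" "a \<otimes> b" d] right[of b a "d \<otimes> inv b"] c by (auto simp: m_assoc)
    show "a \<otimes> b \<sqsubseteq>\<^bsub>L\<^esub> d \<longleftrightarrow> b \<sqsubseteq>\<^bsub>L\<^esub> inv a \<otimes> d"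
      using left[of "inv a" "a \<otimes> b" d] left[of a b "inv a \<otimes> d"] c by (auto simp: cancel_simps)
  qed (simp_all add: carrier_eq)
qed

lemma (in totally_ordered_group) is_lattice_ordered_group: "lattice_ordered_group G L"
proof -
  have join: "x \<squnion>\<^bsub>L\<^esub> y = y" "y \<squnion>\<^bsub>L\<^esub> x = y" "x \<sqinter>\<^bsub>L\<^esub> y = x" "y \<sqinter>\<^bsub>L\<^esub> x = x"
    if "x \<sqsubseteq>\<^bsub>L\<^esub> y" "x \<in> carrier G" "y \<in> carrier G" for x y
    using that weak.le_iff_meet[of x y] weak.le_iff_join[of x y] join_comm[of L] meet_comm[of L] carrier_eq
    by simp_all
  have total: "x \<sqsubseteq>\<^bsub>L\<^esub> y \<or> y \<sqsubseteq>\<^bsub>L\<^esub> x" if "x \<in> carrier G" "y \<in> carrier G" for x y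
    using that total_order_total carrier_eq by simp
  show ?thesis
  proof (intro lattice_ordered_group.intro lattice_ordered_group_axioms.intro)
    fix a x y assume c: "a \<in> carrier G" "x \<in> carrier G" "y \<in> carrier G"
    note m = mult_left_mono[OF c] mult_left_mono[OF c(1,3,2)] mult_right_mono[OF c] mult_right_mono[OF c(1,3,2)]
    show "a \<otimes> (x \<squnion>\<^bsub>L\<^esub> y) = (a \<otimes> x) \<squnion>\<^bsub>L\<^esub> (a \<otimes> y)"
      "(x \<squnion>\<^bsub>L\<^esub> y) \<otimes> a = (x \<otimes> a) \<squnion>\<^bsub>L\<^esub> (y \<otimes> a)"
      "a \<otimes> (x \<sqinter>\<^bsub>L\<^esub> y) = (a \<otimes> x) \<sqinter>\<^bsub>L\<^esub> (a \<otimes> y)"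
      "(x \<sqinter>\<^bsub>L\<^esub> y) \<otimes> a = (x \<otimes> a) \<sqinter>\<^bsub>L\<^esub> (y \<otimes> a)"
      using total[OF c(2,3)] m c join by (elim disjE; simp)+
  qed (rule is_group weak.lattice_axioms carrier_eq)+
qed

section \<open>Ordering torsion-free nilpotent groups\<close>

context group
begin

text \<open>
  A relative cone is the preimage in \<open>K\<close> of the positive cone of a left-invariant order on \<open>K\<close> modulo
  \<open>N\<close>; for \<open>N = {\<one>}\<close> it is a positive cone in \<open>K\<close> itself.
\<close>

definition relative_cone :: "'a set \<Rightarrow> 'a set \<Rightarrow> 'a set \<Rightarrow> bool" where
  "relative_cone N K S \<longleftrightarrow> N \<subseteq> S \<and> S \<subseteq> K \<and> (\<forall>x \<in> S. \<forall>y \<in> S. x \<otimes> y \<in> S) \<and>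
     (\<forall>x \<in> S. inv x \<in> S \<longrightarrow> x \<in> N)"

text \<open>
  Adjoining \<open>x\<close> to a maximal cone \<open>S\<close> yields the set \<open>T\<close> of all \<open>s x\<^sup>k\<close>, which is closed under
  products since \<open>K\<close> is central modulo \<open>N\<close>. By maximality \<open>T\<close> is not a cone, so it contains inverse
  elements \<open>s x\<^sup>k\<close> and \<open>t x\<^sup>l\<close> outside \<open>N\<close>. Their product is \<open>u x\<^sup>k\<^sup>+\<^sup>l\<close> for some \<open>u\<close> in \<open>S\<close>, and
  \<open>k + l\<close> is positive because \<open>S\<close> itself is a cone; so the inverse of \<open>x\<^sup>k\<^sup>+\<^sup>l\<close> is \<open>u\<close>.
\<close>

lemma relative_cone_adjoin:
  assumes N: "N \<lhd> G" and K: "K \<lhd> G"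
    and central: "\<And>x g. \<lbrakk>x \<in> K; g \<in> carrier G\<rbrakk> \<Longrightarrow> commutator G x g \<in> N"
    and S: "relative_cone N K S"
    and max: "\<And>T. \<lbrakk>relative_cone N K T; S \<subseteq> T\<rbrakk> \<Longrightarrow> T = S"
    and x: "x \<in> K" "x \<notin> S"
  shows "\<exists>m \<ge> (1::nat). inv (x [^] m) \<in> S"
proof -
  interpret N: normal N G by (rule N)
  interpret K: normal K G by (rule K)
  have NS: "N \<subseteq> S" and SK: "S \<subseteq> K" and S_mult: "\<And>x y. \<lbrakk>x \<in> S; y \<in> S\<rbrakk> \<Longrightarrow> x \<otimes> y \<in> S"
    and S_anti: "\<And>x. \<lbrakk>x \<in> S; inv x \<in> S\<rbrakk> \<Longrightarrow> x \<in> N"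
    using S by (auto simp: relative_cone_def)
  have Kc: "K \<subseteq> carrier G" by (rule K.subset)
  have xc: "x \<in> carrier G" using x Kc by blast
  have powK: "x [^] k \<in> K" for k :: nat
    by (induction k) (use x in auto)
  define T where "T = {s \<otimes> x [^] k | s (k::nat). s \<in> S}"
  \<comment> \<open>Moving \<open>t\<close> to the left past \<open>x\<^sup>k\<close> costs a commutator, which lies in \<open>N\<close> and hence in \<open>S\<close>.\<close>
  have T_mult: "\<exists>u \<in> S. (s \<otimes> x [^] k) \<otimes> (t \<otimes> x [^] l) = u \<otimes> x [^] (k + l)"
    if s: "s \<in> S" and t: "t \<in> S" for s t and k l :: nat
  proof
    let ?p = "x [^] k"
    let ?c = "commutator G ?p t"
    have c: "s \<in> carrier G" "t \<in> carrier G" using s t SK Kc by auto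
    have "?p \<otimes> ?c \<otimes> inv ?p \<in> N"
      using central[OF powK c(2)] N.inv_op_closed2 xc by simp
    then show "s \<otimes> t \<otimes> (?p \<otimes> ?c \<otimes> inv ?p) \<in> S" using S_mult s t NS by blast
    have "s \<otimes> t \<otimes> (?p \<otimes> ?c \<otimes> inv ?p) \<otimes> x [^] (k + l) = s \<otimes> t \<otimes> (?p \<otimes> ?c) \<otimes> x [^] l"
      using c xc by (simp add: m_assoc cancel_simps flip: nat_pow_mult)
    also have "\<dots> = (s \<otimes> ?p) \<otimes> (t \<otimes> x [^] l)"
      using c xc by (simp add: commutator_def m_assoc cancel_simps)
    finally show "(s \<otimes> ?p) \<otimes> (t \<otimes> x [^] l) = s \<otimes> t \<otimes> (?p \<otimes> ?c \<otimes> inv ?p) \<otimes> x [^] (k + l)"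
      by simp
  qed
  have ST: "S \<subseteq> T"
  proof
    fix s assume "s \<in> S"
    then show "s \<in> T"
      unfolding T_def using SK Kc by (intro CollectI exI[of _ s] exI[of _ 0]) auto
  qed
  have "\<one> \<in> S" using NS by auto
  then have "x \<in> T"
    unfolding T_def using xc by (intro CollectI exI[of _ \<one>] exI[of _ 1]) auto
  then have "\<not> relative_cone N K T" using max[of T] ST x(2) by blast
  moreover have "N \<subseteq> T" using NS ST by blast
  moreover have "T \<subseteq> K" using SK powK by (auto simp: T_def)
  moreover have "\<forall>y \<in> T. \<forall>z \<in> T. y \<otimes> z \<in> T"
    using T_mult unfolding T_def by blast
  ultimately obtain y where y: "y \<in> T" "inv y \<in> T" "y \<notin> N"
    unfolding relative_cone_def by blast
  obtain s k where s: "s \<in> S" "y = s \<otimes> x [^] (k::nat)" using y by (auto simp: T_def)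
  obtain t l where t: "t \<in> S" "inv y = t \<otimes> x [^] (l::nat)" using y by (auto simp: T_def)
  have c: "s \<in> carrier G" "t \<in> carrier G" using s t SK Kc by auto
  obtain u where u: "u \<in> S" "y \<otimes> inv y = u \<otimes> x [^] (k + l)"
    using T_mult[OF s(1) t(1), of k l] unfolding s(2)[symmetric] t(2)[symmetric] by blast
  have "y \<otimes> inv y = \<one>" using s c xc by simp
  then have "u = inv (x [^] (k + l))"
    using u SK Kc xc inv_equality[of u "x [^] (k + l)"] by auto
  moreover have "k + l \<ge> 1"
  proof (rule ccontr)
    assume "\<not> k + l \<ge> 1"
    then have "k = 0" "l = 0" by simp_all
    then have "y = s" "inv y = t" using s(2) t(2) c by simp_all
    then show False using S_anti[of y] s(1) t(1) y(3) by simp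
  qed
  ultimately show ?thesis using u(1) by blast
qed

text \<open>
  Zorn's lemma gives a maximal cone \<open>S\<close>. If neither \<open>x\<close> nor its inverse were in \<open>S\<close>, then by
  \<open>relative_cone_adjoin\<close> the cone would contain the inverse of \<open>x\<^sup>m\<close> and also \<open>x\<^sup>n\<close> for some positive
  \<open>m\<close> and \<open>n\<close>, hence \<open>x\<^sup>m\<^sup>n\<close> together with its inverse. So \<open>x\<^sup>m\<^sup>n\<close> would be in \<open>N\<close>, and \<open>x\<close>
  too, because there is no torsion modulo \<open>N\<close>.
\<close>

lemma total_relative_cone_exists:
  assumes N: "N \<lhd> G" and K: "K \<lhd> G" and NK: "N \<subseteq> K"
    and central: "\<And>x g. \<lbrakk>x \<in> K; g \<in> carrier G\<rbrakk> \<Longrightarrow> commutator G x g \<in> N"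
    and torsion: "\<And>x n. \<lbrakk>x \<in> K; n \<ge> (1::nat); x [^] n \<in> N\<rbrakk> \<Longrightarrow> x \<in> N"
  shows "\<exists>S. relative_cone N K S \<and> (\<forall>x \<in> K. x \<in> S \<or> inv x \<in> S)"
proof -
  interpret N: normal N G by (rule N)
  interpret K: normal K G by (rule K)
  have "\<exists>S \<in> {S. relative_cone N K S}. \<forall>T \<in> {S. relative_cone N K S}. S \<subseteq> T \<longrightarrow> T = S"
  proof (rule subset_Zorn_nonempty)
    have "relative_cone N K N" using NK by (auto simp: relative_cone_def)
    then show "{S. relative_cone N K S} \<noteq> {}" by blast
    fix C assume C: "C \<noteq> {}" "subset.chain {S. relative_cone N K S} C"
    then have cone: "\<And>A. A \<in> C \<Longrightarrow> relative_cone N K A"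
      and chain: "\<And>A B. \<lbrakk>A \<in> C; B \<in> C\<rbrakk> \<Longrightarrow> A \<subseteq> B \<or> B \<subseteq> A"
      by (auto simp: subset_chain_def)
    have common: "\<exists>A \<in> C. x \<in> A \<and> y \<in> A" if "x \<in> \<Union>C" "y \<in> \<Union>C" for x y
      using that chain by blast
    have "x \<otimes> y \<in> \<Union>C" if "x \<in> \<Union>C" "y \<in> \<Union>C" for x y
      using common[OF that] cone unfolding relative_cone_def by blast
    moreover have "x \<in> N" if "x \<in> \<Union>C" "inv x \<in> \<Union>C" for x
      using common[OF that] cone unfolding relative_cone_def by blast
    moreover have "N \<subseteq> \<Union>C" "\<Union>C \<subseteq> K" using C(1) cone unfolding relative_cone_def by blast+
    ultimately show "\<Union>C \<in> {S. relative_cone N K S}" by (auto simp: relative_cone_def)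
  qed
  then obtain S where S: "relative_cone N K S"
    and max: "\<And>T. \<lbrakk>relative_cone N K T; S \<subseteq> T\<rbrakk> \<Longrightarrow> T = S" by blast
  have adjoin: "\<exists>m \<ge> (1::nat). inv (x [^] m) \<in> S" if "x \<in> K" "x \<notin> S" for x
    by (rule relative_cone_adjoin[OF N K central S max that])
  have S_pow: "s [^] n \<in> S" if "s \<in> S" for s and n :: nat
    using that S N.one_closed by (induction n) (auto simp: relative_cone_def)
  have "x \<in> S \<or> inv x \<in> S" if x: "x \<in> K" for x
  proof (rule ccontr)
    assume neg: "\<not> (x \<in> S \<or> inv x \<in> S)"
    have xc: "x \<in> carrier G" using x K.subset by blast
    have nx: "x \<notin> S" "inv x \<notin> S" using neg by auto
    obtain m :: nat where m: "m \<ge> 1" "inv (x [^] m) \<in> S"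
      using adjoin[OF x nx(1)] by blast
    obtain n :: nat where n: "n \<ge> 1" "inv (inv x [^] n) \<in> S"
      using adjoin[OF K.m_inv_closed[OF x] nx(2)] by blast
    have "x [^] (n * m) \<in> S"
      using S_pow[OF n(2), of m] xc by (simp add: nat_pow_inv nat_pow_pow)
    moreover have "inv (x [^] (n * m)) \<in> S"
      using S_pow[OF m(2), of n] xc by (simp add: nat_pow_inv nat_pow_pow mult.commute)
    ultimately have "x [^] (n * m) \<in> N" using S by (auto simp: relative_cone_def)
    moreover have "n * m \<ge> 1" using m n by simp
    ultimately have "x \<in> N" using torsion[OF x] by blast
    then show False using neg S by (auto simp: relative_cone_def)
  qed
  then show ?thesis using S by blast
qed

text \<open>
  The order is lexicographic along the upper central series: an element of \<open>Z\<^sub>i\<^sub>+\<^sub>1\<close> outside \<open>Z\<^sub>i\<close> is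
  positive if it lies in a total cone \<open>S\<close> relative to \<open>Z\<^sub>i\<close>, and on \<open>Z\<^sub>i\<close> the previous cone decides.
  Conjugation changes an element of \<open>Z\<^sub>i\<^sub>+\<^sub>1\<close> only by a factor in \<open>Z\<^sub>i\<close>, so positivity is invariant and
  the order is compatible with multiplication on both sides.
\<close>

lemma upper_central_positive_cone:
  assumes centre: "\<forall>x \<in> upper_central G 1. \<forall>n \<ge> (1::nat). x [^] n = \<one> \<longrightarrow> x = \<one>"
  shows "\<exists>P. relative_cone {\<one>} (upper_central G i) P \<and>
     (\<forall>x \<in> upper_central G i. x \<in> P \<or> inv x \<in> P) \<and>
     (\<forall>x \<in> P. \<forall>g \<in> carrier G. inv g \<otimes> x \<otimes> g \<in> P)"
proof (induction i)
  case 0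
  show ?case by (intro exI[of _ "{\<one>}"]) (simp add: relative_cone_def)
next
  case (Suc i)
  let ?N = "upper_central G i" and ?K = "upper_central G (Suc i)"
  interpret N: normal ?N G by (rule upper_central_normal)
  obtain P where P: "relative_cone {\<one>} ?N P" "\<forall>x \<in> ?N. x \<in> P \<or> inv x \<in> P"
    "\<forall>x \<in> P. \<forall>g \<in> carrier G. inv g \<otimes> x \<otimes> g \<in> P"
    using Suc.IH by (elim exE conjE)
  have central: "commutator G x g \<in> ?N" if "x \<in> ?K" "g \<in> carrier G" for x g
    using that unfolding upper_central.simps(2) by blast
  have torsion: "x \<in> ?N" if "x \<in> ?K" "n \<ge> (1::nat)" "x [^] n \<in> ?N" for x n
    by (rule upper_central_torsion_free_step[OF centre that(2,1,3)])
  have "\<exists>S. relative_cone ?N ?K S \<and> (\<forall>x \<in> ?K. x \<in> S \<or> inv x \<in> S)"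
    by (rule total_relative_cone_exists[OF upper_central_normal upper_central_normal
        upper_central_Suc_mono central torsion])
  then obtain S where S: "relative_cone ?N ?K S" "\<forall>x \<in> ?K. x \<in> S \<or> inv x \<in> S"
    by blast
  have PN: "P \<subseteq> ?N" and P1: "\<one> \<in> P" and P_mult: "\<And>x y. \<lbrakk>x \<in> P; y \<in> P\<rbrakk> \<Longrightarrow> x \<otimes> y \<in> P"
    and P_anti: "\<And>x. \<lbrakk>x \<in> P; inv x \<in> P\<rbrakk> \<Longrightarrow> x = \<one>"
    using P(1) by (auto simp: relative_cone_def)
  have NS: "?N \<subseteq> S" and SK: "S \<subseteq> ?K" and S_mult: "\<And>x y. \<lbrakk>x \<in> S; y \<in> S\<rbrakk> \<Longrightarrow> x \<otimes> y \<in> S"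
    and S_anti: "\<And>x. \<lbrakk>x \<in> S; inv x \<in> S\<rbrakk> \<Longrightarrow> x \<in> ?N"
    using S(1) by (auto simp only: relative_cone_def)
  have Sc: "S \<subseteq> carrier G" using SK upper_central_carrier by blast
  have strict_left: "x \<otimes> y \<in> S - ?N" if x: "x \<in> S - ?N" and y: "y \<in> S" for x y
  proof -
    have c: "x \<in> carrier G" "y \<in> carrier G" using x y Sc by blast+
    have "x \<otimes> y \<notin> ?N"
    proof
      assume n: "x \<otimes> y \<in> ?N"
      have "inv x = y \<otimes> inv (x \<otimes> y)" using c by (simp add: inv_mult_group cancel_simps)
      then have "inv x \<in> S" using S_mult[OF y subsetD[OF NS N.m_inv_closed[OF n]]] by argo
      then show False using S_anti x by blast
    qed
    then show ?thesis using S_mult x y by blast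
  qed
  have strict_right: "y \<otimes> x \<in> S - ?N" if x: "x \<in> S - ?N" and y: "y \<in> ?N" for x y
  proof -
    have c: "x \<in> carrier G" "y \<in> carrier G" using x y Sc N.subset by blast+
    have "y \<otimes> x \<notin> ?N"
    proof
      assume "y \<otimes> x \<in> ?N"
      then have "inv y \<otimes> (y \<otimes> x) \<in> ?N" using y by blast
      then show False using x c by (simp add: cancel_simps)
    qed
    then show ?thesis using S_mult[of y x] x y NS by blast
  qed
  let ?Q = "(S - ?N) \<union> P"
  have "relative_cone {\<one>} ?K ?Q"
    unfolding relative_cone_def
  proof (intro conjI ballI impI)
    show "{\<one>} \<subseteq> ?Q" using P1 by blast
    show "?Q \<subseteq> ?K" using SK PN upper_central_Suc_mono[of i] by blast
    show "x \<otimes> y \<in> ?Q" if xy: "x \<in> ?Q" "y \<in> ?Q" for x y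
    proof (cases "x \<in> S - ?N")
      case True
      moreover have "y \<in> S" using xy(2) PN NS by blast
      ultimately show ?thesis using strict_left by blast
    next
      case False
      then have x: "x \<in> P" using xy(1) by blast
      show ?thesis
      proof (cases "y \<in> S - ?N")
        case True
        then show ?thesis using strict_right[of y x] x PN by blast
      next
        case False
        then show ?thesis using P_mult[OF x] xy(2) by blast
      qed
    qed
    show "x \<in> {\<one>}" if x: "x \<in> ?Q" "inv x \<in> ?Q" for x
    proof -
      have "x \<in> ?N"
        using x S_anti PN NS by blast
      then have "x \<in> P" "inv x \<in> P" using x N.m_inv_closed by blast+
      then show ?thesis using P_anti by blast
    qed
  qed
  moreover have "x \<in> ?Q \<or> inv x \<in> ?Q" if x: "x \<in> ?K" for x
  proof (cases "x \<in> ?N")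
    case True
    then show ?thesis using P(2) by blast
  next
    case False
    moreover have "x \<in> carrier G" using x upper_central_carrier by blast
    ultimately have "inv x \<notin> ?N" using N.m_inv_closed[of "inv x"] by (metis inv_inv)
    then show ?thesis using S(2) x False by blast
  qed
  moreover have "inv g \<otimes> x \<otimes> g \<in> ?Q" if x: "x \<in> ?Q" and g: "g \<in> carrier G" for x g
  proof (cases "x \<in> P")
    case True
    then show ?thesis using P(3) g by blast
  next
    case False
    then have x: "x \<in> S - ?N" using x by blast
    have xc: "x \<in> carrier G" using x Sc by blast
    have "commutator G x g \<in> S" using central x SK g NS by blast
    then have "x \<otimes> commutator G x g \<in> S - ?N" by (rule strict_left[OF x])
    moreover have "x \<otimes> commutator G x g = inv g \<otimes> x \<otimes> g"
      using xc g by (simp add: commutator_def m_assoc cancel_simps)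
    ultimately show ?thesis by simp
  qed
  ultimately show ?case by blast
qed

lemma totally_ordered_group_of_cone:
  assumes P: "relative_cone {\<one>} (carrier G) P" and total: "\<forall>x \<in> carrier G. x \<in> P \<or> inv x \<in> P"
    and conj: "\<forall>x \<in> P. \<forall>g \<in> carrier G. inv g \<otimes> x \<otimes> g \<in> P"
  shows "totally_ordered_group G
    \<lparr>carrier = carrier G, eq = (=), le = (\<lambda>x y. inv x \<otimes> y \<in> P)\<rparr>" (is "totally_ordered_group G ?L")
proof -
  have P1: "\<one> \<in> P" and P_mult: "\<And>x y. \<lbrakk>x \<in> P; y \<in> P\<rbrakk> \<Longrightarrow> x \<otimes> y \<in> P"
    and P_anti: "\<And>x. \<lbrakk>x \<in> P; inv x \<in> P\<rbrakk> \<Longrightarrow> x = \<one>"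
    using P by (auto simp: relative_cone_def)
  have flip: "inv (inv x \<otimes> y) = inv y \<otimes> x" if "x \<in> carrier G" "y \<in> carrier G" for x y
    using that by (simp add: inv_mult_group)
  have "partial_order ?L"
  proof
    fix x y z assume c: "x \<in> carrier ?L" "y \<in> carrier ?L" "z \<in> carrier ?L"
      and le: "x \<sqsubseteq>\<^bsub>?L\<^esub> y" "y \<sqsubseteq>\<^bsub>?L\<^esub> z"
    have "(inv x \<otimes> y) \<otimes> (inv y \<otimes> z) \<in> P" using le P_mult by simp
    then show "x \<sqsubseteq>\<^bsub>?L\<^esub> z" using c by (simp add: m_assoc cancel_simps)
  next
    fix x y assume c: "x \<in> carrier ?L" "y \<in> carrier ?L" and le: "x \<sqsubseteq>\<^bsub>?L\<^esub> y" "y \<sqsubseteq>\<^bsub>?L\<^esub> x"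
    have "inv x \<otimes> y = \<one>" using c le flip by (intro P_anti) auto
    then show "x .=\<^bsub>?L\<^esub> y" using c inv_mult_eq_one_iff by simp
  qed (simp_all add: P1)
  moreover have "x \<sqsubseteq>\<^bsub>?L\<^esub> y \<or> y \<sqsubseteq>\<^bsub>?L\<^esub> x" if c: "x \<in> carrier ?L" "y \<in> carrier ?L" for x y
    using bspec[OF total, of "inv x \<otimes> y"] c flip by auto
  ultimately have order: "total_order ?L" by (rule partial_order.total_orderI)
  show ?thesis
  proof (intro totally_ordered_group.intro totally_ordered_group_axioms.intro order is_group)
    fix a x y assume c: "a \<in> carrier G" "x \<in> carrier G" "y \<in> carrier G" and le: "x \<sqsubseteq>\<^bsub>?L\<^esub> y"
    show "a \<otimes> x \<sqsubseteq>\<^bsub>?L\<^esub> a \<otimes> y" using c le by (simp add: inv_mult_group m_assoc cancel_simps)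
    have "inv a \<otimes> (inv x \<otimes> y) \<otimes> a \<in> P" using conj le c by simp
    then show "x \<otimes> a \<sqsubseteq>\<^bsub>?L\<^esub> y \<otimes> a" using c by (simp add: inv_mult_group m_assoc)
  qed simp
qed

lemma nilpotent_torsion_free_orderable:
  assumes nil: "nilpotent_group c G" and tf: "torsion_free G"
  shows "\<exists>L :: 'a gorder. totally_ordered_group G L"
proof -
  have "\<forall>x \<in> upper_central G 1. \<forall>n \<ge> (1::nat). x [^] n = \<one> \<longrightarrow> x = \<one>"
    using tf upper_central_carrier[of 1] unfolding torsion_free_def by blast
  from upper_central_positive_cone[OF this, of c] obtain P where
    "relative_cone {\<one>} (carrier G) P" "\<forall>x \<in> carrier G. x \<in> P \<or> inv x \<in> P"
    "\<forall>x \<in> P. \<forall>g \<in> carrier G. inv g \<otimes> x \<otimes> g \<in> P"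
    using nil[unfolded nilpotent_group_iff_upper_central] by (elim exE conjE) (simp only:)
  then show ?thesis using totally_ordered_group_of_cone by blast
qed

end

section \<open>The equivalence\<close>

lemma all_equivalentI:
  assumes "P4 \<Longrightarrow> P1" "P1 \<Longrightarrow> P5" "P5 \<Longrightarrow> P2" "P2 \<Longrightarrow> P3" "P3 \<Longrightarrow> P4"
  shows "all_equivalent [P1, P2, P3, P4, P5]"
  using assms unfolding all_equivalent_def by auto

theorem theorem3p8:
  fixes M :: "('a, 'm) monoid_scheme" and c :: nat
  assumes "c \<ge> 1" and "monoid M" and "carrier M \<lesssim> (UNIV :: 'b set)"
  shows "all_equivalent
    [\<exists>(G :: 'b monoid) (L :: 'b gorder). lattice_ordered_group G L \<and> nilpotent_group c G \<and> submonoid_of M G,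
     nilpotent_monoid c M \<and> monoid_cancel M \<and> unique_roots M,
     \<exists>G :: 'b monoid. group_of_quotients G M \<and> nilpotent_group c G \<and> torsion_free G,
     \<exists>(G :: 'b monoid) (L :: 'b gorder). totally_ordered_group G L \<and> nilpotent_group c G \<and> submonoid_of M G,
     \<exists>(R :: 'b monoid) (L :: 'b gorder) ldiv rdiv. residuated_lattice R L ldiv rdiv \<and> monoid_cancel R \<and>
        nilpotent_monoid c R \<and> submonoid_of M R]"
proof -
  note M = \<open>monoid M\<close>
  obtain k where c: "c = Suc k" using \<open>c \<ge> 1\<close> by (cases c) auto
  show ?thesis
  proof (rule all_equivalentI)
    assume "\<exists>(G :: 'b monoid) (L :: 'b gorder). totally_ordered_group G L \<and> nilpotent_group c G \<and> submonoid_of M G"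
    then show "\<exists>(G :: 'b monoid) (L :: 'b gorder). lattice_ordered_group G L \<and> nilpotent_group c G \<and> submonoid_of M G"
      using totally_ordered_group.is_lattice_ordered_group by blast
  next
    assume "\<exists>(G :: 'b monoid) (L :: 'b gorder). lattice_ordered_group G L \<and> nilpotent_group c G \<and> submonoid_of M G"
    then obtain G :: "'b monoid" and L :: "'b gorder"
      where G: "lattice_ordered_group G L" "nilpotent_group c G" "submonoid_of M G" by blast
    interpret G: lattice_ordered_group G L by (rule G)
    have "nilpotent_monoid c G"
      using G(2) G.nilpotent_group_imp_nilpotent_monoid c by simp
    then show "\<exists>(R :: 'b monoid) (L :: 'b gorder) ldiv rdiv. residuated_lattice R L ldiv rdiv \<and>
        monoid_cancel R \<and> nilpotent_monoid c R \<and> submonoid_of M R"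
      using G.residuated_lattice_inv G.is_monoid_cancel G(3) by blast
  next
    assume "\<exists>(R :: 'b monoid) (L :: 'b gorder) ldiv rdiv. residuated_lattice R L ldiv rdiv \<and>
        monoid_cancel R \<and> nilpotent_monoid c R \<and> submonoid_of M R"
    then obtain R :: "'b monoid" and L :: "'b gorder" and ldiv rdiv
      where R: "residuated_lattice R L ldiv rdiv" "monoid_cancel R" "nilpotent_monoid c R" "submonoid_of M R"
      by blast
    interpret R: residuated_lattice R L ldiv rdiv by (rule R)
    interpret O: ore_monoid R using nilpotent_cancel_ore R(2,3) c by blast
    have "unique_roots O.ore_group"
      using group_of_quotients_nilpotent_unique_roots(2)[OF R.monoid_axioms O.ore_group_of_quotients _
          R.commuting_roots_unique[OF R(2)]] R(3) c by blast
    moreover have "O.left_mult \<one>\<^bsub>R\<^esub> = \<one>\<^bsub>O.ore_group\<^esub>"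
      by (auto simp: O.left_mult_def O.ore_group_def)
    ultimately have roots: "unique_roots R"
      using unique_roots_mon[OF R.monoid_axioms group.is_monoid[OF O.ore_group_group] O.left_mult_mon]
      by blast
    obtain f where f: "f \<in> mon M R" "f \<one>\<^bsub>M\<^esub> = \<one>\<^bsub>R\<^esub>"
      using submonoid_ofE[OF M R.monoid_axioms R(4)] .
    show "nilpotent_monoid c M \<and> monoid_cancel M \<and> unique_roots M"
      using nilpotent_monoid_mon[OF M f(1)] monoid_cancel_mon[OF M f(1) R(2)]
        unique_roots_mon[OF M R.monoid_axioms f roots] R(3) c by blast
  next
    assume 2: "nilpotent_monoid c M \<and> monoid_cancel M \<and> unique_roots M"
    then interpret O: ore_monoid M using nilpotent_cancel_ore c by blast
    have "carrier O.ore_group \<lesssim> (UNIV :: 'b set)"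
      using 2 by (intro lepoll_trans[OF O.ore_group_lepoll] lepoll_trans[OF _ assms(3)]
          unique_roots_square_lepoll) auto
    then obtain \<phi> :: "('a \<times> 'a) set \<Rightarrow> 'b" where \<phi>: "inj_on \<phi> (carrier O.ore_group)"
      by (auto simp: lepoll_def)
    let ?G = "image_group \<phi> O.ore_group"
    have G: "group_of_quotients ?G M"
      by (rule group_of_quotients_image_group[OF M O.ore_group_of_quotients \<phi>])
    have "commuting_roots_unique M"
      using 2 unfolding unique_roots_def commuting_roots_unique_def by blast
    then have "nilpotent_group c ?G" "unique_roots ?G"
      using group_of_quotients_nilpotent_unique_roots[OF M G] 2 c by auto
    moreover have "group ?G" using G by (simp add: group_of_quotients_def)
    ultimately show "\<exists>G :: 'b monoid. group_of_quotients G M \<and> nilpotent_group c G \<and> torsion_free G"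
      using G group.unique_roots_imp_torsion_free by blast
  next
    assume "\<exists>G :: 'b monoid. group_of_quotients G M \<and> nilpotent_group c G \<and> torsion_free G"
    then obtain G :: "'b monoid"
      where G: "group_of_quotients G M" "nilpotent_group c G" "torsion_free G" by blast
    have "group G" "submonoid_of M G"
      using G(1) by (auto simp: group_of_quotients_def submonoid_of_def)
    then show "\<exists>(G :: 'b monoid) (L :: 'b gorder). totally_ordered_group G L \<and> nilpotent_group c G \<and> submonoid_of M G"
      using group.nilpotent_torsion_free_orderable G(2,3) by blast
  qed
qed

end
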